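(* Let $\xi\in(0,1)$ and $\varepsilon>0$ be constants and $t=n^{\xi}$. No quantum algorithm computes the LZ77 factorization of texts $X[1\,.\,.\,n]$ using $o(\sqrt{zn})$ queries for all texts with $z\in[t^{1-\varepsilon}\,.\,.\,t]$; likewise, no quantum algorithm computes the run-length-encoded BWT using $o(\sqrt{rn})$ queries for all texts with $r\in[t^{1-\varepsilon}\,.\,.\,t]$. This holds for every alphabet of size at least two.
   Context: $z$ is the number of phrases of the LZ77 factorization of $X$ (greedy left-to-right parsing into longest fragments that also occur starting at an earlier position, or single characters when none exist). $\mathrm{BWT}[i]=X[\mathrm{SA}[i]-1]$ if $\mathrm{SA}[i]\ne1$ and the sentinel otherwise, where $\mathrm{SA}$ is the suffix array; $r$ is the number of maximal runs of equal characters in $\mathrm{BWT}$, and the run-length-encoded BWT lists these runs. Quantum oracle access to $X$ is via $|i,b\rangle\mapsto|i,b\oplus X[i]\rangle$; algorithms are bounded-error and queries are calls to this oracle. *)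

theory Defs
  imports Complex_Main "HOL-Library.List_Lexorder" "HOL-Library.Landau_Symbols"
begin

section \<open>Texts, LZ77 and the run-length-encoded BWT\<close>

text \<open>
  Texts are lists over the ordered alphabet \<open>{0, \<dots>, \<sigma> - 1}\<close>. Positions are counted from 0, so that
  position \<open>i\<close> here is position \<open>i + 1\<close> in the usual one-based notation \<open>X[1..n]\<close>.
\<close>

type_synonym str = "nat list"

definition occurs_earlier :: "str \<Rightarrow> nat \<Rightarrow> nat \<Rightarrow> bool" where
  "occurs_earlier X i l \<longleftrightarrow>
     1 \<le> l \<and> i + l \<le> length X \<and> (\<exists>j<i. take l (drop j X) = take l (drop i X))"

definition lz_len :: "str \<Rightarrow> nat \<Rightarrow> nat" where
  "lz_len X i =
     (if \<exists>l. occurs_earlier X i l then (GREATEST l. occurs_earlier X i l) else 1)"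

lemma lz_len_pos: "0 < lz_len X i"
proof (cases "\<exists>l. occurs_earlier X i l")
  case True
  then have "occurs_earlier X i (GREATEST l. occurs_earlier X i l)"
    by (rule GreatestI_ex_nat[where b = "length X"]) (auto simp: occurs_earlier_def)
  then have "1 \<le> (GREATEST l. occurs_earlier X i l)"
    unfolding occurs_earlier_def[of X i "Greatest P" for P] by blast
  with True show ?thesis
    by (simp add: lz_len_def)
qed (simp add: lz_len_def)

text \<open>
  The earlier occurrence of a phrase may overlap the phrase itself. A factorization is the list of
  its phrases; up to query-free post-processing this carries the same information as the list of
  (source, length) pairs and literal characters.
\<close>

function lz_from :: "str \<Rightarrow> nat \<Rightarrow> nat list list" where
  "lz_from X i =
     (if i < length X then take (lz_len X i) (drop i X) # lz_from X (i + lz_len X i) else [])"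
  by pat_completeness auto
termination
  by (relation "measure (\<lambda>(X, i). length X - i)") (auto simp: lz_len_pos diff_less_mono2)

declare lz_from.simps [simp del]

definition lz77 :: "str \<Rightarrow> nat list list" where
  "lz77 X = lz_from X 0"

definition lz_size :: "str \<Rightarrow> nat" where
  "lz_size X = length (lz77 X)"

text \<open>The order on suffixes is the lexicographic one, where a proper prefix is smaller.\<close>

definition suffix_array :: "str \<Rightarrow> nat list" where
  "suffix_array X = sort_key (\<lambda>i. drop i X) [0..<length X]"

text \<open>The sentinel is \<^term>\<open>None\<close>.\<close>

definition bwt :: "str \<Rightarrow> nat option list" where
  "bwt X = map (\<lambda>p. if p \<noteq> 0 then Some (X ! (p - 1)) else None) (suffix_array X)"

function run_length_encode :: "'a list \<Rightarrow> ('a \<times> nat) list" where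
  "run_length_encode [] = []"
| "run_length_encode (x # xs) =
     (x, Suc (length (takeWhile (\<lambda>y. y = x) xs))) # run_length_encode (dropWhile (\<lambda>y. y = x) xs)"
  by pat_completeness auto
termination
  by (relation "measure length") (auto simp: less_Suc_eq_le length_dropWhile_le)

definition rlbwt :: "str \<Rightarrow> (nat option \<times> nat) list" where
  "rlbwt X = run_length_encode (bwt X)"

definition bwt_runs :: "str \<Rightarrow> nat" where
  "bwt_runs X = length (rlbwt X)"


section \<open>Quantum query algorithms\<close>

text \<open>
  Computational basis states \<open>|i, b, w\<rangle>\<close>: query index \<open>i\<close>, answer register \<open>b\<close> (a bit string, read
  as a number, that is just long enough for one character) and workspace \<open>w\<close>. States and operators
  are given by their coordinates in this basis.
\<close>

type_synonym basis_state = "nat \<times> nat \<times> nat"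
type_synonym qstate = "basis_state \<Rightarrow> complex"
type_synonym qoperator = "basis_state \<Rightarrow> basis_state \<Rightarrow> complex"

definition char_bits :: "nat \<Rightarrow> nat" where
  "char_bits \<sigma> = (LEAST k. \<sigma> \<le> 2 ^ k)"

definition basis :: "nat \<Rightarrow> nat \<Rightarrow> nat \<Rightarrow> basis_state set" where
  "basis \<sigma> n W = {..<n} \<times> {..<2 ^ char_bits \<sigma>} \<times> {..<W}"

definition apply_op :: "basis_state set \<Rightarrow> qoperator \<Rightarrow> qstate \<Rightarrow> qstate" where
  "apply_op B U \<psi> = (\<lambda>x. \<Sum>y\<in>B. U x y * \<psi> y)"

definition unitary_op :: "basis_state set \<Rightarrow> qoperator \<Rightarrow> bool" where
  "unitary_op B U \<longleftrightarrow>
     (\<forall>x\<in>B. \<forall>y\<in>B. (\<Sum>u\<in>B. cnj (U u x) * U u y) = of_bool (x = y)) \<and>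
     (\<forall>x\<in>B. \<forall>y\<in>B. (\<Sum>u\<in>B. U x u * cnj (U y u)) = of_bool (x = y))"

definition ket :: "basis_state \<Rightarrow> qstate" where
  "ket x = (\<lambda>y. of_bool (y = x))"

definition oracle_op :: "str \<Rightarrow> qoperator" where
  "oracle_op X = (\<lambda>x (i, b, w). ket (i, Bit_Operations.xor b (X ! i), w) x)"

text \<open>
  An algorithm for a fixed text length alternates arbitrary unitaries with oracle calls. So that the
  number of queries may depend on the text, a projective measurement after each unitary decides
  whether to halt: the basis states \<open>x\<close> with \<open>readout x = Some y\<close> are the halting ones, with
  output \<open>y\<close>. All other measurements can be deferred and are thus covered.
\<close>

record 'o qalgorithm =
  workspace :: nat
  unitary :: "nat \<Rightarrow> qoperator"
  readout :: "basis_state \<Rightarrow> 'o option"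

definition alg_basis :: "nat \<Rightarrow> nat \<Rightarrow> 'o qalgorithm \<Rightarrow> basis_state set" where
  "alg_basis \<sigma> n A = basis \<sigma> n (workspace A)"

definition valid_alg :: "nat \<Rightarrow> nat \<Rightarrow> 'o qalgorithm \<Rightarrow> bool" where
  "valid_alg \<sigma> n A \<longleftrightarrow> (\<forall>j. unitary_op (alg_basis \<sigma> n A) (unitary A j))"

text \<open>
  \<open>alg_state \<sigma> A X j\<close> is the state just before the halting measurement that follows the \<open>j\<close>-th query.
  It is not renormalized after a non-halting outcome: its squared norm is the probability that the
  algorithm makes at least \<open>j\<close> queries.
\<close>

primrec alg_state :: "nat \<Rightarrow> 'o qalgorithm \<Rightarrow> str \<Rightarrow> nat \<Rightarrow> qstate" where
  "alg_state \<sigma> A X 0 =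
     apply_op (alg_basis \<sigma> (length X) A) (unitary A 0) (ket (0, 0, 0))"
| "alg_state \<sigma> A X (Suc j) =
     (let B = alg_basis \<sigma> (length X) A;
          \<phi> = (\<lambda>x. if readout A x = None then alg_state \<sigma> A X j x else 0)
      in apply_op B (unitary A (Suc j)) (apply_op B (oracle_op X) \<phi>))"

definition prob_output_within :: "nat \<Rightarrow> 'o qalgorithm \<Rightarrow> str \<Rightarrow> nat \<Rightarrow> 'o \<Rightarrow> real" where
  "prob_output_within \<sigma> A X q y =
     (\<Sum>j\<le>q. \<Sum>x | x \<in> alg_basis \<sigma> (length X) A \<and> readout A x = Some y.
        (cmod (alg_state \<sigma> A X j x))\<^sup>2)"

text \<open>
  The family \<open>A\<close> (one algorithm per text length) computes \<open>f\<close> on the texts in \<open>S\<close> with error at most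
  \<open>1/3\<close>, using at most \<open>q X\<close> queries on text \<open>X\<close>. Exceeding the query bound counts as an error, and
  nothing is required on texts outside \<open>S\<close>.
\<close>

definition quantum_computes ::
    "nat \<Rightarrow> str set \<Rightarrow> (str \<Rightarrow> 'o) \<Rightarrow> (nat \<Rightarrow> 'o qalgorithm) \<Rightarrow> (str \<Rightarrow> nat) \<Rightarrow> bool" where
  "quantum_computes \<sigma> S f A q \<longleftrightarrow>
     (\<forall>n\<ge>1. valid_alg \<sigma> n (A n)) \<and>
     (\<forall>X\<in>S. prob_output_within \<sigma> (A (length X)) X (q X) (f X) \<ge> 2 / 3)"

text \<open>
  The texts over \<open>{0, \<dots>, \<sigma> - 1}\<close> whose measure \<open>\<mu>\<close> lies in \<open>[t powr (1 - \<epsilon>) .. t]\<close>, where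
  \<open>t = n powr \<xi>\<close> for the length \<open>n \<ge> 1\<close> of the text.
\<close>

definition texts_in_range :: "nat \<Rightarrow> real \<Rightarrow> real \<Rightarrow> (str \<Rightarrow> nat) \<Rightarrow> str set" where
  "texts_in_range \<sigma> \<xi> \<epsilon> \<mu> =
     {X. X \<noteq> [] \<and> set X \<subseteq> {..<\<sigma>} \<and>
         (let t = real (length X) powr \<xi>
          in t powr (1 - \<epsilon>) \<le> real (\<mu> X) \<and> real (\<mu> X) \<le> t)}"

text \<open>\<open>n \<rightarrow> \<infinity>\<close>, uniformly over the texts of length \<open>n\<close> in \<open>S\<close>.\<close>

definition long_texts :: "str set \<Rightarrow> str filter" where
  "long_texts S = inf (filtercomap length at_top) (principal S)"

end

theory Submission
  imports Defs "HOL-Library.Multiset" "HOL-Real_Asymp.Real_Asymp"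
begin

text \<open>
  Consider the texts \<open>P Z 0\<close>, where \<open>P\<close> is the concatenation of all binary words of length
  \<open>L \<approx> (1 - \<delta>) log t\<close> and \<open>Z\<close> is a bit string with \<open>k\<close> or \<open>k + 1\<close> ones, \<open>k \<approx> t / 8\<close>. Both measures are at
  most \<open>O(1)\<close> times the number of ones, hence at most \<open>t\<close>. Both are at least \<open>2 ^ L / L\<close> because all
  binary words of length \<open>L\<close> occur: each phrase end is straddled by fewer than \<open>L\<close> leftmost occurrences,
  and the \<open>2 ^ (L - 1)\<close> words of length \<open>L - 1\<close>, which all have two left extensions, give disjoint
  intervals of the suffix array in each of which the BWT changes. Either output determines the
  number of ones, and Ambainis's adversary method shows that telling \<open>k\<close> ones from \<open>k + 1\<close> takes
  \<open>\<Omega>(sqrt (k n))\<close> queries.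
\<close>

section \<open>The adversary method\<close>

definition inner_on :: "basis_state set \<Rightarrow> qstate \<Rightarrow> qstate \<Rightarrow> complex" where
  "inner_on B \<phi> \<psi> = (\<Sum>x\<in>B. cnj (\<phi> x) * \<psi> x)"

lemma finite_basis: "finite (basis \<sigma> n W)"
  by (simp add: basis_def)

lemma inner_on_unitary:
  assumes "finite B" "unitary_op B U"
  shows "inner_on B (apply_op B U \<phi>) (apply_op B U \<psi>) = inner_on B \<phi> \<psi>"
proof -
  have "inner_on B (apply_op B U \<phi>) (apply_op B U \<psi>) =
      (\<Sum>x\<in>B. \<Sum>y\<in>B. \<Sum>z\<in>B. cnj (\<phi> y) * \<psi> z * (cnj (U x y) * U x z))"
    by (simp add: inner_on_def apply_op_def sum_product mult_ac)
      (intro sum.cong refl sum.swap)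
  also have "\<dots> = (\<Sum>y\<in>B. \<Sum>z\<in>B. cnj (\<phi> y) * \<psi> z * (\<Sum>x\<in>B. cnj (U x y) * U x z))"
    by (subst sum.swap, rule sum.cong[OF refl], subst sum.swap) (simp add: sum_distrib_left)
  also have "\<dots> = (\<Sum>y\<in>B. \<Sum>z\<in>B. cnj (\<phi> y) * \<psi> z * of_bool (y = z))"
    using assms by (intro sum.cong refl) (simp add: unitary_op_def)
  also have "\<dots> = inner_on B \<phi> \<psi>"
    using assms(1) by (simp add: inner_on_def of_bool_def if_distrib sum.delta cong: if_cong)
  finally show ?thesis .
qed

lemma xor_less_exp:
  fixes a b :: nat
  assumes "a < 2 ^ k" "b < 2 ^ k"
  shows "Bit_Operations.xor a b < 2 ^ k"
  using assms by (metis take_bit_nat_eq_self_iff take_bit_xor)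

lemma bij_betw_xor:
  fixes c :: nat
  assumes "c < 2 ^ k"
  shows "bij_betw (\<lambda>b. Bit_Operations.xor b c) {..<2 ^ k} {..<2 ^ k}"
  by (rule bij_betw_byWitness[where f' = "\<lambda>b. Bit_Operations.xor b c"])
    (auto simp: xor.assoc assms xor_less_exp)

lemma apply_oracle:
  assumes "(i, b, w) \<in> basis \<sigma> n W" "X ! i < 2 ^ char_bits \<sigma>"
  shows "apply_op (basis \<sigma> n W) (oracle_op X) \<phi> (i, b, w) = \<phi> (i, Bit_Operations.xor b (X ! i), w)"
proof -
  have "(i, Bit_Operations.xor b (X ! i), w) \<in> basis \<sigma> n W"
    using assms by (auto simp: basis_def xor_less_exp)
  moreover have "oracle_op X (i, b, w) y * \<phi> y =
      (if y = (i, Bit_Operations.xor b (X ! i), w) then \<phi> y else 0)" for y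
    by (cases y) (auto simp: oracle_op_def ket_def xor.assoc)
  ultimately show ?thesis
    by (simp add: apply_op_def finite_basis)
qed

text \<open>The query magnitude of position \<open>i\<close>: the weight with which an oracle call
  on \<open>\<phi>\<close> asks for that position.\<close>

definition query_weight :: "nat \<Rightarrow> nat \<Rightarrow> qstate \<Rightarrow> nat \<Rightarrow> real" where
  "query_weight \<sigma> W \<phi> i = (\<Sum>p\<in>{..<2 ^ char_bits \<sigma>} \<times> {..<W}. (cmod (\<phi> (i, p)))\<^sup>2)"

lemma query_weight_nonneg: "0 \<le> query_weight \<sigma> W \<phi> i"
  by (simp add: query_weight_def sum_nonneg)

lemma sum_basis: "sum g (basis \<sigma> n W) = (\<Sum>i<n. \<Sum>p\<in>{..<2 ^ char_bits \<sigma>} \<times> {..<W}. g (i, p))"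
  by (simp add: basis_def sum.cartesian_product)

lemma sum_query_weight:
  "(\<Sum>i<n. query_weight \<sigma> W \<phi> i) = (\<Sum>x\<in>basis \<sigma> n W. (cmod (\<phi> x))\<^sup>2)"
  by (simp add: query_weight_def sum_basis)

lemma sum_xor_reindex:
  fixes c :: nat
  assumes "c < 2 ^ k"
  shows "(\<Sum>(b, w)\<in>{..<2 ^ k} \<times> {..<W}. g (Bit_Operations.xor b c) w) =
    (\<Sum>(b, w)\<in>{..<2 ^ k} \<times> {..<W}. g b w)"
proof -
  have "(\<Sum>b<2 ^ k. \<Sum>w<W. g (Bit_Operations.xor b c) w) = (\<Sum>b<2 ^ k. \<Sum>w<W. g b w)"
    by (rule sum.reindex_bij_betw[OF bij_betw_xor[OF assms]])
  then show ?thesis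
    by (simp add: sum.cartesian_product)
qed

text \<open>Weighted AM-GM. The free weight \<open>\<alpha>\<close> serves later to balance the two
  sides of the adversary relation and to exploit a skewed distribution of mass.\<close>

lemma cmod_mult_le_weighted:
  assumes "0 < \<alpha>"
  shows "cmod (cnj a * b) \<le> (\<alpha> * (cmod a)\<^sup>2 + (cmod b)\<^sup>2 / \<alpha>) / 2"
proof -
  have "0 \<le> (\<alpha> * cmod a - cmod b)\<^sup>2 / \<alpha>"
    using assms by simp
  also have "\<dots> = \<alpha> * (cmod a)\<^sup>2 + (cmod b)\<^sup>2 / \<alpha> - 2 * (cmod a * cmod b)"
    using assms by (simp add: power2_eq_square field_simps)
  finally show ?thesis
    by (simp add: norm_mult)
qed

lemma inner_on_oracle:
  fixes W :: nat
  assumes "\<And>i. i < n \<Longrightarrow> X ! i < 2 ^ char_bits \<sigma>" "\<And>i. i < n \<Longrightarrow> Y ! i < 2 ^ char_bits \<sigma>"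
  defines "B \<equiv> basis \<sigma> n W"
  shows "inner_on B (apply_op B (oracle_op X) \<phi>) (apply_op B (oracle_op Y) \<psi>) =
    (\<Sum>i<n. \<Sum>(b, w)\<in>{..<2 ^ char_bits \<sigma>} \<times> {..<W}.
      cnj (\<phi> (i, Bit_Operations.xor b (X ! i), w)) * \<psi> (i, Bit_Operations.xor b (Y ! i), w))"
  unfolding inner_on_def B_def sum_basis
proof (intro sum.cong refl)
  fix i and p :: "nat \<times> nat"
  assume "i \<in> {..<n}" "p \<in> {..<2 ^ char_bits \<sigma>} \<times> {..<W}"
  then obtain b w where "p = (b, w)" "(i, b, w) \<in> basis \<sigma> n W" "i < n"
    by (auto simp: basis_def)
  then show "cnj (apply_op (basis \<sigma> n W) (oracle_op X) \<phi> (i, p)) *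
      apply_op (basis \<sigma> n W) (oracle_op Y) \<psi> (i, p) =
      (case p of (b, w) \<Rightarrow>
        cnj (\<phi> (i, Bit_Operations.xor b (X ! i), w)) * \<psi> (i, Bit_Operations.xor b (Y ! i), w))"
    using assms(1,2) by (simp add: apply_oracle)
qed

text \<open>XOR with a common character only permutes the answer register, so all query indices
  except \<open>d\<close> cancel. The block at \<open>d\<close> before the query and the one after
  it each contribute half of the bound, by weighted AM-GM.\<close>

lemma oracle_inner_diff:
  fixes W :: nat
  assumes "d < n"
    and agree: "\<And>i. i < n \<Longrightarrow> i \<noteq> d \<Longrightarrow> X ! i = Y ! i"
    and X: "\<And>i. i < n \<Longrightarrow> X ! i < 2 ^ char_bits \<sigma>"
    and Y: "\<And>i. i < n \<Longrightarrow> Y ! i < 2 ^ char_bits \<sigma>"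
    and "0 < \<alpha>"
  defines "B \<equiv> basis \<sigma> n W"
  shows "cmod (inner_on B (apply_op B (oracle_op X) \<phi>) (apply_op B (oracle_op Y) \<psi>) - inner_on B \<phi> \<psi>)
    \<le> \<alpha> * query_weight \<sigma> W \<phi> d + query_weight \<sigma> W \<psi> d / \<alpha>"
proof -
  let ?P = "{..<2 ^ char_bits \<sigma>} \<times> {..<W}"
  define s where "s i = (\<Sum>(b, w)\<in>?P. cnj (\<phi> (i, b, w)) * \<psi> (i, b, w))" for i
  define s' where "s' i = (\<Sum>(b, w)\<in>?P. cnj (\<phi> (i, Bit_Operations.xor b (X ! i), w)) *
      \<psi> (i, Bit_Operations.xor b (Y ! i), w))" for i
  have "inner_on B \<phi> \<psi> = (\<Sum>i<n. s i)"
    by (simp add: inner_on_def B_def sum_basis s_def case_prod_unfold)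
  moreover have "inner_on B (apply_op B (oracle_op X) \<phi>) (apply_op B (oracle_op Y) \<psi>) = (\<Sum>i<n. s' i)"
    unfolding B_def s'_def by (rule inner_on_oracle[OF X Y])
  moreover have "s' i = s i" if "i < n" "i \<noteq> d" for i
    using sum_xor_reindex[OF X[OF that(1)], of "\<lambda>b w. cnj (\<phi> (i, b, w)) * \<psi> (i, b, w)"]
      agree[OF that] by (simp add: s_def s'_def)
  then have "(\<Sum>i<n. s' i - s i) = (\<Sum>i\<in>{d}. s' i - s i)"
    using \<open>d < n\<close> by (intro sum.mono_neutral_right) auto
  ultimately have eq: "inner_on B (apply_op B (oracle_op X) \<phi>) (apply_op B (oracle_op Y) \<psi>) -
      inner_on B \<phi> \<psi> = s' d - s d"
    by (simp add: sum_subtractf)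
  have "cmod (s d) \<le> (\<Sum>(b, w)\<in>?P. (\<alpha> * (cmod (\<phi> (d, b, w)))\<^sup>2 + (cmod (\<psi> (d, b, w)))\<^sup>2 / \<alpha>) / 2)"
    unfolding s_def case_prod_unfold
    by (rule sum_norm_le) (rule cmod_mult_le_weighted[OF \<open>0 < \<alpha>\<close>])
  also have "\<dots> = (\<alpha> * query_weight \<sigma> W \<phi> d + query_weight \<sigma> W \<psi> d / \<alpha>) / 2"
    by (simp add: query_weight_def case_prod_unfold sum.distrib sum_distrib_left
        flip: sum_divide_distrib)
  finally have 1: "cmod (s d) \<le> (\<alpha> * query_weight \<sigma> W \<phi> d + query_weight \<sigma> W \<psi> d / \<alpha>) / 2" .
  have "cmod (s' d) \<le> (\<Sum>(b, w)\<in>?P. (\<alpha> * (cmod (\<phi> (d, Bit_Operations.xor b (X ! d), w)))\<^sup>2 +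
      (cmod (\<psi> (d, Bit_Operations.xor b (Y ! d), w)))\<^sup>2 / \<alpha>) / 2)"
    unfolding s'_def case_prod_unfold
    by (rule sum_norm_le) (rule cmod_mult_le_weighted[OF \<open>0 < \<alpha>\<close>])
  also have "\<dots> = (\<alpha> * (\<Sum>(b, w)\<in>?P. (cmod (\<phi> (d, Bit_Operations.xor b (X ! d), w)))\<^sup>2) +
      (\<Sum>(b, w)\<in>?P. (cmod (\<psi> (d, Bit_Operations.xor b (Y ! d), w)))\<^sup>2) / \<alpha>) / 2"
    by (simp add: case_prod_unfold sum.distrib sum_distrib_left flip: sum_divide_distrib)
  also have "\<dots> = (\<alpha> * query_weight \<sigma> W \<phi> d + query_weight \<sigma> W \<psi> d / \<alpha>) / 2"
    unfolding query_weight_def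
    using sum_xor_reindex[OF X[OF \<open>d < n\<close>], of "\<lambda>b w. (cmod (\<phi> (d, b, w)))\<^sup>2" W]
      sum_xor_reindex[OF Y[OF \<open>d < n\<close>], of "\<lambda>b w. (cmod (\<psi> (d, b, w)))\<^sup>2" W]
    by (simp add: case_prod_unfold)
  finally have "cmod (s' d) \<le> (\<alpha> * query_weight \<sigma> W \<phi> d + query_weight \<sigma> W \<psi> d / \<alpha>) / 2" .
  with 1 show ?thesis
    unfolding eq using norm_triangle_ineq4[of "s' d" "s d"] by argo
qed

text \<open>A single oracle permutes the basis states. This is the case that conserves total
  probability.\<close>

lemma oracle_inner_same:
  fixes W :: nat
  assumes X: "\<And>i. i < n \<Longrightarrow> X ! i < 2 ^ char_bits \<sigma>"
  defines "B \<equiv> basis \<sigma> n W"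
  shows "inner_on B (apply_op B (oracle_op X) \<phi>) (apply_op B (oracle_op X) \<psi>) = inner_on B \<phi> \<psi>"
proof -
  let ?P = "{..<2 ^ char_bits \<sigma>} \<times> {..<W}"
  have "inner_on B (apply_op B (oracle_op X) \<phi>) (apply_op B (oracle_op X) \<psi>) =
      (\<Sum>i<n. \<Sum>(b, w)\<in>?P. cnj (\<phi> (i, Bit_Operations.xor b (X ! i), w)) *
        \<psi> (i, Bit_Operations.xor b (X ! i), w))"
    unfolding B_def by (rule inner_on_oracle[OF X X])
  also have "\<dots> = (\<Sum>i<n. \<Sum>(b, w)\<in>?P. cnj (\<phi> (i, b, w)) * \<psi> (i, b, w))"
    using X by (intro sum.cong refl sum_xor_reindex[where g = "\<lambda>b w. cnj (\<phi> (i, b, w)) * \<psi> (i, b, w)" for i]) auto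
  also have "\<dots> = inner_on B \<phi> \<psi>"
    by (simp add: inner_on_def B_def sum_basis case_prod_unfold)
  finally show ?thesis .
qed

section \<open>Runs with deferred measurements\<close>

definition running_part :: "'o qalgorithm \<Rightarrow> qstate \<Rightarrow> qstate" where
  "running_part A \<phi> = (\<lambda>x. if readout A x = None then \<phi> x else 0)"

definition halting :: "nat \<Rightarrow> nat \<Rightarrow> 'o qalgorithm \<Rightarrow> basis_state set" where
  "halting \<sigma> n A = {x \<in> alg_basis \<sigma> n A. readout A x \<noteq> None}"

text \<open>
  The inner product of the runs on \<open>X\<close> and \<open>Y\<close> with all measurements deferred: the parts that halted
  after different numbers of queries are orthogonal.
\<close>

definition overlap :: "nat \<Rightarrow> 'o qalgorithm \<Rightarrow> nat \<Rightarrow> str \<Rightarrow> str \<Rightarrow> complex" where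
  "overlap \<sigma> A j X Y =
     (\<Sum>i<j. inner_on (halting \<sigma> (length X) A) (alg_state \<sigma> A X i) (alg_state \<sigma> A Y i)) +
     inner_on (alg_basis \<sigma> (length X) A) (alg_state \<sigma> A X j) (alg_state \<sigma> A Y j)"

text \<open>Before the first query the state does not depend on the text, and it is a unit vector
  once \<open>(0, 0, 0)\<close> really is a basis state.\<close>

lemma overlap_0:
  assumes "valid_alg \<sigma> n A" "length X = n" "length Y = n" "(0, 0, 0) \<in> alg_basis \<sigma> n A"
  shows "overlap \<sigma> A 0 X Y = 1"
proof -
  have "finite (alg_basis \<sigma> n A)"
    by (simp add: alg_basis_def finite_basis)
  moreover have "inner_on (alg_basis \<sigma> n A) (ket (0, 0, 0)) (ket (0, 0, 0)) = 1"
    using calculation assms(4) by (simp add: inner_on_def ket_def of_bool_def if_distrib sum.delta cong: if_cong)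
  ultimately show ?thesis
    using assms by (simp add: overlap_def valid_alg_def inner_on_unitary)
qed

lemma inner_on_split_halting:
  "inner_on (alg_basis \<sigma> n A) \<phi> \<psi> =
     inner_on (halting \<sigma> n A) \<phi> \<psi> + inner_on (alg_basis \<sigma> n A) (running_part A \<phi>) (running_part A \<psi>)"
proof -
  have fin: "finite (alg_basis \<sigma> n A)"
    by (simp add: alg_basis_def finite_basis)
  have "inner_on (halting \<sigma> n A) \<phi> \<psi> =
      (\<Sum>x\<in>alg_basis \<sigma> n A. if readout A x \<noteq> None then cnj (\<phi> x) * \<psi> x else 0)"
    unfolding inner_on_def halting_def by (rule sum.inter_filter[OF fin])
  then show ?thesis
    by (auto simp: inner_on_def running_part_def simp flip: sum.distrib intro!: sum.cong)
qed

text \<open>The part halting after \<open>j\<close> queries only moves from the last summand into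
  the sum, and the unitary preserves inner products. What remains is the effect of one oracle call
  on the running parts.\<close>

lemma overlap_Suc:
  fixes j :: nat
  assumes "valid_alg \<sigma> n A" "length X = n" "length Y = n"
  defines "B \<equiv> alg_basis \<sigma> n A"
  defines "\<phi> \<equiv> running_part A (alg_state \<sigma> A X j)" and "\<psi> \<equiv> running_part A (alg_state \<sigma> A Y j)"
  shows "overlap \<sigma> A (Suc j) X Y - overlap \<sigma> A j X Y =
    inner_on B (apply_op B (oracle_op X) \<phi>) (apply_op B (oracle_op Y) \<psi>) - inner_on B \<phi> \<psi>"
proof -
  have "inner_on B (alg_state \<sigma> A X (Suc j)) (alg_state \<sigma> A Y (Suc j)) =
      inner_on B (apply_op B (oracle_op X) \<phi>) (apply_op B (oracle_op Y) \<psi>)"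
    using assms(1-3) inner_on_unitary[of B "unitary A (Suc j)"]
    by (simp add: Let_def valid_alg_def B_def \<phi>_def \<psi>_def running_part_def[abs_def]
        alg_basis_def finite_basis)
  then show ?thesis
    using inner_on_split_halting[of \<sigma> n A "alg_state \<sigma> A X j" "alg_state \<sigma> A Y j"] assms(2,3)
    by (simp add: overlap_def B_def \<phi>_def \<psi>_def)
qed

text \<open>Conservation of probability: halted and current parts together keep squared norm
  one.\<close>

lemma overlap_self:
  assumes "valid_alg \<sigma> n A" "length X = n" "(0, 0, 0) \<in> alg_basis \<sigma> n A"
    and "\<And>i. i < n \<Longrightarrow> X ! i < 2 ^ char_bits \<sigma>"
  shows "overlap \<sigma> A j X X = 1"
proof (induction j)
  case 0
  show ?case
    using overlap_0 assms by blast
next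
  case (Suc j)
  then show ?case
    using overlap_Suc[OF assms(1,2,2), of j] oracle_inner_same[OF assms(4)]
    by (simp add: alg_basis_def)
qed

text \<open>The running part is bounded by one nonnegative summand of the conserved total. Hence the
  query weights of each round sum to at most one.\<close>

lemma sum_cmod_sq_running_part_le:
  assumes "valid_alg \<sigma> n A" "length X = n" "(0, 0, 0) \<in> alg_basis \<sigma> n A"
    and "\<And>i. i < n \<Longrightarrow> X ! i < 2 ^ char_bits \<sigma>"
  shows "(\<Sum>x\<in>alg_basis \<sigma> n A. (cmod (running_part A (alg_state \<sigma> A X j) x))\<^sup>2) \<le> 1"
proof -
  have sq: "inner_on C \<phi> \<phi> = of_real (\<Sum>x\<in>C. (cmod (\<phi> x))\<^sup>2)" for C \<phi>
    by (simp add: inner_on_def complex_norm_square[symmetric] mult.commute)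
  have "of_real ((\<Sum>i<j. \<Sum>x\<in>halting \<sigma> n A. (cmod (alg_state \<sigma> A X i x))\<^sup>2) +
      (\<Sum>x\<in>alg_basis \<sigma> n A. (cmod (alg_state \<sigma> A X j x))\<^sup>2)) = (1 :: complex)"
    using overlap_self[OF assms] assms(2) by (simp add: overlap_def sq)
  then have "(\<Sum>i<j. \<Sum>x\<in>halting \<sigma> n A. (cmod (alg_state \<sigma> A X i x))\<^sup>2) +
      (\<Sum>x\<in>alg_basis \<sigma> n A. (cmod (alg_state \<sigma> A X j x))\<^sup>2) = 1"
    by (metis of_real_eq_1_iff)
  moreover have "0 \<le> (\<Sum>i<j. \<Sum>x\<in>halting \<sigma> n A. (cmod (alg_state \<sigma> A X i x))\<^sup>2)"
    by (simp add: sum_nonneg)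
  moreover have "(\<Sum>x\<in>alg_basis \<sigma> n A. (cmod (running_part A (alg_state \<sigma> A X j) x))\<^sup>2) \<le>
      (\<Sum>x\<in>alg_basis \<sigma> n A. (cmod (alg_state \<sigma> A X j x))\<^sup>2)"
    by (intro sum_mono) (simp add: running_part_def)
  ultimately show ?thesis
    by linarith
qed

section \<open>From success probability to small overlap\<close>

text \<open>On \<open>K1\<close> the vector \<open>a\<close> has mass at least 2/3 and
  \<open>b\<close> at most 1/3; off \<open>K1\<close> it is the other way round. The vectors are
  therefore far from parallel.\<close>

lemma inner_le_of_distinguishing_measurement:
  fixes a b :: "'k \<Rightarrow> complex"
  assumes "finite K" "K1 \<subseteq> K" "K2 \<subseteq> K" "K1 \<inter> K2 = {}"
    and a: "(\<Sum>k\<in>K. (cmod (a k))\<^sup>2) = 1" and b: "(\<Sum>k\<in>K. (cmod (b k))\<^sup>2) = 1"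
    and a1: "(\<Sum>k\<in>K1. (cmod (a k))\<^sup>2) \<ge> 2 / 3" and b2: "(\<Sum>k\<in>K2. (cmod (b k))\<^sup>2) \<ge> 2 / 3"
  shows "Re (\<Sum>k\<in>K. cnj (a k) * b k) \<le> 17 / 18"
proof -
  have split: "sum g K = sum g K1 + sum g (K - K1)" for g :: "'k \<Rightarrow> real"
    using assms(1,2) by (simp add: sum.subset_diff add.commute)
  have "(\<Sum>k\<in>K2. (cmod (b k))\<^sup>2) \<le> (\<Sum>k\<in>K - K1. (cmod (b k))\<^sup>2)"
    using assms(1-4) by (intro sum_mono2) auto
  moreover have "Re (\<Sum>k\<in>K. cnj (a k) * b k) \<le> (\<Sum>k\<in>K. cmod (cnj (a k) * b k))"
    by (rule order_trans[OF complex_Re_le_cmod norm_sum])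
  \<comment> \<open>The ideal weight for masses 2/3 and 1/3 is 1 / sqrt 2. Its rational substitute
    3/4 here, with 4/3 off \<open>K1\<close>, gives 25/24 - 7/24 * 1/3 = 17/18.\<close>
  moreover have "(\<Sum>k\<in>K1. cmod (cnj (a k) * b k)) \<le>
      (\<Sum>k\<in>K1. (3 / 4 * (cmod (a k))\<^sup>2 + (cmod (b k))\<^sup>2 / (3 / 4)) / 2)"
    by (rule sum_mono, rule cmod_mult_le_weighted) simp
  moreover have "\<dots> = 3 / 8 * (\<Sum>k\<in>K1. (cmod (a k))\<^sup>2) + 2 / 3 * (\<Sum>k\<in>K1. (cmod (b k))\<^sup>2)"
    by (simp add: sum_distrib_left sum.distrib[symmetric] add_divide_distrib mult.commute)
  moreover have "(\<Sum>k\<in>K - K1. cmod (cnj (a k) * b k)) \<le>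
      (\<Sum>k\<in>K - K1. (4 / 3 * (cmod (a k))\<^sup>2 + (cmod (b k))\<^sup>2 / (4 / 3)) / 2)"
    by (rule sum_mono, rule cmod_mult_le_weighted) simp
  moreover have "\<dots> = 2 / 3 * (\<Sum>k\<in>K - K1. (cmod (a k))\<^sup>2) + 3 / 8 * (\<Sum>k\<in>K - K1. (cmod (b k))\<^sup>2)"
    by (simp add: sum_distrib_left sum.distrib[symmetric] add_divide_distrib mult.commute)
  ultimately show ?thesis
    using a b a1 b2 unfolding split by linarith
qed

lemma overlap_le_of_success:
  assumes "valid_alg \<sigma> n A" "length X = n" "length Y = n" "(0, 0, 0) \<in> alg_basis \<sigma> n A"
    and X: "\<And>i. i < n \<Longrightarrow> X ! i < 2 ^ char_bits \<sigma>" and Y: "\<And>i. i < n \<Longrightarrow> Y ! i < 2 ^ char_bits \<sigma>"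
    and u: "prob_output_within \<sigma> A X Q u \<ge> 2 / 3" and v: "prob_output_within \<sigma> A Y Q v \<ge> 2 / 3"
    and "u \<noteq> v"
  shows "Re (overlap \<sigma> A Q X Y) \<le> 17 / 18"
proof -
  let ?B = "alg_basis \<sigma> n A" and ?H = "halting \<sigma> n A"
  \<comment> \<open>The coordinates of the run with deferred measurements: the halted blocks for
    \<open>i < Q\<close> and the whole state after \<open>Q\<close> queries. Over \<open>K\<close>
    the overlap is an ordinary inner product of unit vectors, and different outputs occupy disjoint
    subsets.\<close>
  define K where "K = (SIGMA i:{..Q}. if i < Q then ?H else ?B)"
  define out where "out y = {..Q} \<times> {x \<in> ?B. readout A x = Some y}" for y
  have fin: "finite ?B" "finite ?H"
    by (auto simp: alg_basis_def finite_basis halting_def)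
  have K: "sum g K = (\<Sum>i<Q. \<Sum>x\<in>?H. g (i, x)) + (\<Sum>x\<in>?B. g (Q, x))"
    for g :: "nat \<times> basis_state \<Rightarrow> 'b :: comm_monoid_add"
  proof -
    have "sum g K = (\<Sum>i\<le>Q. \<Sum>x\<in>(if i < Q then ?H else ?B). g (i, x))"
      using fin by (simp add: K_def sum.Sigma)
    also have "\<dots> = (\<Sum>i<Q. \<Sum>x\<in>?H. g (i, x)) + (\<Sum>x\<in>?B. g (Q, x))"
      by (simp add: lessThan_Suc_atMost[symmetric])
    finally show ?thesis .
  qed
  have overlap: "overlap \<sigma> A Q Z Z' =
      (\<Sum>(i, x)\<in>K. cnj (alg_state \<sigma> A Z i x) * alg_state \<sigma> A Z' i x)" if "length Z = n" for Z Z'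
    using that by (simp add: overlap_def inner_on_def K)
  have norm: "(\<Sum>k\<in>K. (cmod (case_prod (alg_state \<sigma> A Z) k))\<^sup>2) = 1"
    if "length Z = n" "\<And>i. i < n \<Longrightarrow> Z ! i < 2 ^ char_bits \<sigma>" for Z
  proof -
    have "of_real (\<Sum>k\<in>K. (cmod (case_prod (alg_state \<sigma> A Z) k))\<^sup>2) = overlap \<sigma> A Q Z Z"
      by (simp add: overlap[OF that(1)] case_prod_unfold complex_norm_square mult.commute del: of_real_power)
    also have "\<dots> = 1"
      using overlap_self assms(1,4) that by blast
    finally show ?thesis
      by (metis of_real_eq_1_iff)
  qed
  have prob: "prob_output_within \<sigma> A Z Q y = (\<Sum>k\<in>out y. (cmod (case_prod (alg_state \<sigma> A Z) k))\<^sup>2)"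
    if "length Z = n" for Z y
    using that by (simp add: prob_output_within_def out_def sum.cartesian_product case_prod_unfold)
  have "finite K"
    using fin by (auto simp: K_def)
  moreover have "out y \<subseteq> K" for y
    by (auto simp: out_def K_def halting_def)
  moreover have "out u \<inter> out v = {}"
    using \<open>u \<noteq> v\<close> by (auto simp: out_def)
  ultimately have "Re (\<Sum>k\<in>K. cnj (case_prod (alg_state \<sigma> A X) k) * case_prod (alg_state \<sigma> A Y) k) \<le> 17 / 18"
    using assms prob norm by (intro inner_le_of_distinguishing_measurement[of K "out u" "out v"]) auto
  then show ?thesis
    using overlap[OF assms(2), of Y] by (simp add: case_prod_unfold)
qed

section \<open>Weight counting and the adversary bound\<close>

text \<open>Different partners of \<open>x\<close> are assigned different positions, so the weights
  met at \<open>x\<close> form a subsum of its total weight, which is at most one.\<close>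

lemma sum_relation_le_card_Domain:
  fixes g :: "'a \<Rightarrow> nat \<Rightarrow> real"
  assumes "finite R"
    and d: "\<And>x y. (x, y) \<in> R \<Longrightarrow> d x y < n"
    and inj: "\<And>x. inj_on (d x) (R `` {x})"
    and g0: "\<And>x i. 0 \<le> g x i"
    and g1: "\<And>x. x \<in> Domain R \<Longrightarrow> (\<Sum>i<n. g x i) \<le> 1"
  shows "(\<Sum>(x, y)\<in>R. g x (d x y)) \<le> card (Domain R)"
proof -
  have "R = Sigma (Domain R) (\<lambda>x. R `` {x})"
    by auto
  moreover have fin: "finite (Domain R)" "finite (R `` {x})" for x
    using \<open>finite R\<close> by (auto simp: finite_Domain intro: finite_subset[of _ "snd ` R"] image_eqI[rotated])
  ultimately have "(\<Sum>(x, y)\<in>R. g x (d x y)) = (\<Sum>x\<in>Domain R. \<Sum>y\<in>R `` {x}. g x (d x y))"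
    by (simp add: sum.Sigma)
  also have "\<dots> \<le> (\<Sum>x\<in>Domain R. 1)"
  proof (rule sum_mono)
    fix x assume "x \<in> Domain R"
    have "(\<Sum>y\<in>R `` {x}. g x (d x y)) = (\<Sum>i\<in>d x ` (R `` {x}). g x i)"
      using inj by (simp add: sum.reindex)
    also have "\<dots> \<le> (\<Sum>i<n. g x i)"
      using d g0 by (intro sum_mono2) auto
    finally show "(\<Sum>y\<in>R `` {x}. g x (d x y)) \<le> 1"
      using g1[OF \<open>x \<in> Domain R\<close>] by linarith
  qed
  finally show ?thesis
    by simp
qed

text \<open>
  Ambainis's bound \<open>sqrt (m m' / (l l'))\<close>, for \<open>l = l' = 1\<close>.
\<close>

theorem adversary_bound:
  fixes A :: "'o qalgorithm" and R :: "(str \<times> str) set" and v w :: real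
  assumes valid: "valid_alg \<sigma> n A"
    and R: "finite R" "R \<noteq> {}"
    and len: "\<And>X. X \<in> Field R \<Longrightarrow> length X = n"
    and char: "\<And>X i. X \<in> Field R \<Longrightarrow> i < n \<Longrightarrow> X ! i < 2 ^ char_bits \<sigma>"
    and d: "\<And>X Y. (X, Y) \<in> R \<Longrightarrow> d X Y < n"
    and agree: "\<And>X Y i. (X, Y) \<in> R \<Longrightarrow> i < n \<Longrightarrow> i \<noteq> d X Y \<Longrightarrow> X ! i = Y ! i"
    and inj1: "\<And>X. inj_on (\<lambda>Y. d X Y) (R `` {X})"
    and inj2: "\<And>Y. inj_on (\<lambda>X. d X Y) (R\<inverse> `` {Y})"
    and v: "0 < v" "v * card (Domain R) \<le> card R"
    and w: "0 < w" "w * card (Range R) \<le> card R"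
    and distinct: "\<And>X Y. (X, Y) \<in> R \<Longrightarrow> f X \<noteq> f Y"
    and success: "\<And>X. X \<in> Field R \<Longrightarrow> prob_output_within \<sigma> A X Q (f X) \<ge> 2 / 3"
  shows "sqrt (v * w) \<le> 36 * real Q"
proof -
  \<comment> \<open>This choice equalizes the two error terms: \<open>\<alpha> / v\<close> and
    \<open>1 / (w * \<alpha>)\<close> both become \<open>1 / sqrt (v * w)\<close>.\<close>
  define \<alpha> where "\<alpha> = sqrt (v / w)"
  define qw where "qw j X = query_weight \<sigma> (workspace A) (running_part A (alg_state \<sigma> A X j))" for j X
  \<comment> \<open>The progress measure. It starts at \<open>card R\<close>, must fall to at most
    17/18 of that, and one query lowers it by at most
    \<open>2 * card R / sqrt (v * w)\<close>.\<close>
  define F where "F j = (\<Sum>(X, Y)\<in>R. Re (overlap \<sigma> A j X Y))" for j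
  have \<alpha>: "0 < \<alpha>"
    using v w by (simp add: \<alpha>_def)
  have Field: "X \<in> Field R" "Y \<in> Field R" if "(X, Y) \<in> R" for X Y
    using that by (auto simp: Field_def)
  obtain X0 where X0: "X0 \<in> Field R"
    using R(2) by (auto simp: Field_def)
  have zero: "(0, 0, 0) \<in> alg_basis \<sigma> n A"
  proof (rule ccontr)
    assume "\<not> ?thesis"
    moreover have "0 < n"
      using R(2) d by fastforce
    ultimately have "workspace A = 0"
      by (auto simp: alg_basis_def basis_def)
    then have "prob_output_within \<sigma> A X0 Q (f X0) = 0"
      by (simp add: prob_output_within_def alg_basis_def basis_def)
    with success[OF X0] show False
      by simp
  qed
  have qw1: "(\<Sum>i<n. qw j X i) \<le> 1" if "X \<in> Field R" for j X
    using sum_cmod_sq_running_part_le[OF valid len[OF that] zero char[OF that]]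
    by (simp add: qw_def sum_query_weight alg_basis_def)
  have step: "F j - F (Suc j) \<le> 2 * card R / sqrt (v * w)" for j
  proof -
    have "F j - F (Suc j) = (\<Sum>(X, Y)\<in>R. Re (overlap \<sigma> A j X Y - overlap \<sigma> A (Suc j) X Y))"
      by (simp add: F_def sum_subtractf case_prod_unfold)
    also have "\<dots> \<le> (\<Sum>(X, Y)\<in>R. \<alpha> * qw j X (d X Y) + qw j Y (d X Y) / \<alpha>)"
    proof (rule sum_mono, clarify)
      fix X Y assume XY: "(X, Y) \<in> R"
      have "cmod (overlap \<sigma> A (Suc j) X Y - overlap \<sigma> A j X Y) \<le>
          \<alpha> * qw j X (d X Y) + qw j Y (d X Y) / \<alpha>"
        unfolding overlap_Suc[OF valid len[OF Field(1)[OF XY]] len[OF Field(2)[OF XY]]] qw_def alg_basis_def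
        using d[OF XY] agree[OF XY] char[OF Field(1)[OF XY]] char[OF Field(2)[OF XY]] \<alpha>
        by (intro oracle_inner_diff) auto
      then show "Re (overlap \<sigma> A j X Y - overlap \<sigma> A (Suc j) X Y) \<le>
          \<alpha> * qw j X (d X Y) + qw j Y (d X Y) / \<alpha>"
        using complex_Re_le_cmod order_trans by (metis norm_minus_commute)
    qed
    also have "\<dots> = \<alpha> * (\<Sum>(X, Y)\<in>R. qw j X (d X Y)) + (\<Sum>(X, Y)\<in>R. qw j Y (d X Y)) / \<alpha>"
      by (simp add: sum.distrib sum_distrib_left sum_divide_distrib case_prod_unfold)
    \<comment> \<open>The weights of the second text are to be grouped by \<open>Y\<close>, so the
      counting lemma is applied to the converse relation.\<close>
    also have "(\<Sum>(X, Y)\<in>R. qw j Y (d X Y)) = (\<Sum>(Y, X)\<in>R\<inverse>. qw j Y (d X Y))"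
      by (rule sum.reindex_bij_witness[of _ prod.swap prod.swap]) auto
    also have "\<alpha> * (\<Sum>(X, Y)\<in>R. qw j X (d X Y)) + (\<Sum>(Y, X)\<in>R\<inverse>. qw j Y (d X Y)) / \<alpha> \<le>
        \<alpha> * card (Domain R) + card (Domain (R\<inverse>)) / \<alpha>"
    proof (intro add_mono mult_left_mono divide_right_mono)
      show "(\<Sum>(X, Y)\<in>R. qw j X (d X Y)) \<le> card (Domain R)"
        using R d inj1 qw1 by (intro sum_relation_le_card_Domain[where n = n])
          (auto simp: qw_def query_weight_nonneg Field_def)
      show "(\<Sum>(Y, X)\<in>R\<inverse>. qw j Y (d X Y)) \<le> card (Domain (R\<inverse>))"
        using R d inj2 qw1 by (intro sum_relation_le_card_Domain[where n = n and d = "\<lambda>Y X. d X Y"])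
          (auto simp: qw_def query_weight_nonneg Field_def)
    qed (use \<alpha> in auto)
    also have "\<dots> \<le> \<alpha> * (card R / v) + (card R / w) / \<alpha>"
      using v w \<alpha> by (intro add_mono mult_left_mono divide_right_mono) (auto simp: field_simps)
    also have "\<dots> = 2 * card R / sqrt (v * w)"
    proof -
      have "v = sqrt v * sqrt v" "w = sqrt w * sqrt w"
        using v(1) w(1) by auto
      then have "\<alpha> / v = 1 / sqrt (v * w)" "1 / (w * \<alpha>) = 1 / sqrt (v * w)"
        using v(1) w(1) by (simp_all add: \<alpha>_def real_sqrt_divide real_sqrt_mult field_simps)
      then have "card R * (\<alpha> / v) + card R * (1 / (w * \<alpha>)) = card R * (2 / sqrt (v * w))"
        by simp
      then show ?thesis
        by (simp add: mult_ac)
    qed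
    finally show ?thesis .
  qed
  have "F 0 - F Q = (\<Sum>j<Q. F j - F (Suc j))"
    by (simp add: sum_lessThan_telescope')
  also have "\<dots> \<le> (\<Sum>j<Q. 2 * card R / sqrt (v * w))"
    by (intro sum_mono step)
  finally have "F 0 - F Q \<le> Q * (2 * card R / sqrt (v * w))"
    by simp
  moreover have "F 0 = card R"
  proof -
    have "F 0 = (\<Sum>(X, Y)\<in>R. 1)"
      unfolding F_def using overlap_0[OF valid _ _ zero] Field len
      by (intro sum.cong) (auto simp del: overlap_0)
    then show ?thesis
      by simp
  qed
  moreover have "F Q \<le> (\<Sum>(X, Y)\<in>R. 17 / 18)"
    unfolding F_def
  proof (rule sum_mono, clarify)
    fix X Y assume XY: "(X, Y) \<in> R"
    show "Re (overlap \<sigma> A Q X Y) \<le> 17 / 18"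
      using Field[OF XY] by (intro overlap_le_of_success[OF valid len len zero char char success success distinct[OF XY]])
  qed
  then have "F Q \<le> card R * (17 / 18)"
    by simp
  moreover have "Q * (2 * card R / sqrt (v * w)) = card R * (2 * Q / sqrt (v * w))"
    by simp
  \<comment> \<open>The required loss of 1/18 against a loss of \<open>2 / sqrt (v * w)\<close> per
    query yields the constant 36.\<close>
  ultimately have "card R * (1 / 18) \<le> card R * (2 * Q / sqrt (v * w))"
    by linarith
  then have "1 / 18 \<le> 2 * Q / sqrt (v * w)"
    using R by (subst (asm) mult_le_cancel_left_pos) (auto simp: card_gt_0_iff)
  then show ?thesis
    using v(1) w(1) by (simp add: field_simps)
qed

section \<open>Texts containing all binary words\<close>

definition ones :: "str \<Rightarrow> nat" where
  "ones X = length (filter (\<lambda>c. c \<noteq> 0) X)"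

definition has_all_words :: "nat \<Rightarrow> str \<Rightarrow> bool" where
  "has_all_words L X \<longleftrightarrow>
     (\<forall>w. length w = L \<and> set w \<subseteq> {0, 1} \<longrightarrow> (\<exists>p. p + L \<le> length X \<and> take L (drop p X) = w))"

lemma card_binary_words: "card {w :: str. length w = L \<and> set w \<subseteq> {0, 1}} = 2 ^ L"
  using card_lists_length_eq[of "{0, 1 :: nat}" L] by (simp add: conj_commute numeral_2_eq_2)

text \<open>A de Bruijn sequence would be shorter by a factor of about \<open>L\<close>, but the
  choice of \<open>L\<close> in \<open>eventually_word_length\<close> absorbs this factor.\<close>

definition all_words :: "nat \<Rightarrow> str" where
  "all_words L = concat (List.n_lists L [0, 1])"

lemma length_all_words: "length (all_words L) = L * 2 ^ L"
proof -
  have "map length (List.n_lists L [0, 1 :: nat]) = replicate (2 ^ L) L"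
    by (intro replicate_eqI) (auto simp: length_n_lists length_n_lists_elem numeral_2_eq_2)
  then show ?thesis
    by (simp add: all_words_def length_concat sum_list_replicate mult.commute)
qed

lemma set_all_words: "set (all_words L) \<subseteq> {0, 1}"
  by (auto simp: all_words_def set_n_lists)

lemma has_all_words_append: "has_all_words L (all_words L @ Z)"
  unfolding has_all_words_def
proof (intro allI impI)
  fix w :: str assume w: "length w = L \<and> set w \<subseteq> {0, 1}"
  then have "w \<in> set (List.n_lists L [0, 1])"
    by (auto simp: set_n_lists)
  then obtain us vs where "List.n_lists L [0, 1] = us @ w # vs"
    by (meson split_list)
  then have "all_words L @ Z = concat us @ w @ concat vs @ Z"
    by (simp add: all_words_def)
  with w show "\<exists>p. p + L \<le> length (all_words L @ Z) \<and> take L (drop p (all_words L @ Z)) = w"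
    by (intro exI[of _ "length (concat us)"]) auto
qed

section \<open>Bounds on the number of LZ77 phrases\<close>

lemma lz_len_occurs:
  assumes "occurs_earlier X i l"
  shows "occurs_earlier X i (lz_len X i)" and "l \<le> lz_len X i"
proof -
  have bound: "\<And>l. occurs_earlier X i l \<Longrightarrow> l \<le> length X"
    by (auto simp: occurs_earlier_def)
  have eq: "lz_len X i = (GREATEST l. occurs_earlier X i l)"
    using assms by (auto simp: lz_len_def)
  show "occurs_earlier X i (lz_len X i)"
    unfolding eq using assms bound by (rule GreatestI_nat)
  show "l \<le> lz_len X i"
    unfolding eq using assms bound by (rule Greatest_le_nat)
qed

lemma lz_len_cases:
  "occurs_earlier X i (lz_len X i) \<or> lz_len X i = 1"
proof (cases "\<exists>l. occurs_earlier X i l")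
  case True
  then show ?thesis
    using lz_len_occurs(1) by blast
qed (simp add: lz_len_def)

lemma lz_len_le: "i < length X \<Longrightarrow> i + lz_len X i \<le> length X"
  using lz_len_cases[of X i] by (auto simp: occurs_earlier_def)

lemma concat_lz_from: "concat (lz_from X i) = drop i X"
proof (induction X i rule: lz_from.induct)
  case (1 X i)
  then show ?case
    by (subst lz_from.simps) (auto simp: add.commute[of i] append_take_drop_id simp flip: drop_drop)
qed

lemma concat_lz77: "concat (lz77 X) = X"
  by (simp add: lz77_def concat_lz_from)

text \<open>
  The leftmost occurrence of a word of length at least two is not contained in a single phrase, since
  that phrase would itself have an earlier occurrence; hence it straddles the end of a phrase.
\<close>

lemma card_new_words_le:
  assumes "2 \<le> L"
  shows "card ((\<lambda>p. take L (drop p X)) ` {p. i \<le> p \<and> p + L \<le> length X} -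
      (\<lambda>p. take L (drop p X)) ` {..<i}) \<le> L * length (lz_from X i)"
proof (induction X i rule: lz_from.induct)
  case (1 X i)
  let ?w = "\<lambda>p. take L (drop p X)"
  let ?D = "\<lambda>i. ?w ` {p. i \<le> p \<and> p + L \<le> length X} - ?w ` {..<i}"
  have fin: "finite (?D j)" for j
    by (rule finite_Diff, rule finite_imageI, rule finite_subset[of _ "{..length X}"]) auto
  show ?case
  proof (cases "i < length X")
    case False
    then have none: "{p. i \<le> p \<and> p + L \<le> length X} = {}"
      using assms by auto
    show ?thesis
      unfolding none by simp
  next
    case True
    define l where "l = lz_len X i"
    \<comment> \<open>Sort the new words by the start of their leftmost occurrence: within the last
      \<open>L\<close> positions before the phrase end, or from the phrase end on. Words that end
      exactly with the phrase are included, hence \<open>L\<close> starts rather than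
      \<open>L - 1\<close>.\<close>
    have "?D i \<subseteq> ?w ` {i + l - L..<i + l} \<union> ?D (i + l)"
    proof
      fix u assume "u \<in> ?D i"
      then obtain p where p: "i \<le> p" "p + L \<le> length X" "u = ?w p" and new: "u \<notin> ?w ` {..<i}"
        by auto
      define p' where "p' = (LEAST p'. ?w p' = u)"
      have p': "?w p' = u" and "p' \<le> p"
        unfolding p'_def using p by (auto intro: LeastI Least_le)
      have least: "p' \<le> q" if "?w q = u" for q
        unfolding p'_def using that by (rule Least_le)
      have "i \<le> p'"
        using new p' by force
      have "i + l - L \<le> p'" if "p' < i + l"
      proof (rule ccontr)
        assume "\<not> i + l - L \<le> p'"
        then have inside: "p' + L < i + l" by simp
        then have "l \<noteq> 1"
          using \<open>i \<le> p'\<close> assms by simp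
        then obtain j where j: "j < i" "take l (drop j X) = take l (drop i X)"
          using lz_len_cases[of X i] by (auto simp: l_def occurs_earlier_def)
        have "take L (drop (p' - i) (take l (drop j X))) = take L (drop (p' - i) (take l (drop i X)))"
          using j(2) by simp
        then have "?w (j + (p' - i)) = ?w p'"
          using inside \<open>i \<le> p'\<close> by (simp add: drop_take add.commute min_absorb1)
        then show False
          using least[of "j + (p' - i)"] p' j(1) \<open>i \<le> p'\<close> by simp
      qed
      moreover have "u \<in> ?D (i + l)" if "\<not> p' < i + l"
        using p \<open>p' \<le> p\<close> least that by force
      ultimately show "u \<in> ?w ` {i + l - L..<i + l} \<union> ?D (i + l)"
        using p' by force
    qed
    then have "card (?D i) \<le> card (?w ` {i + l - L..<i + l} \<union> ?D (i + l))"
      using fin by (intro card_mono) auto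
    also have "\<dots> \<le> card (?w ` {i + l - L..<i + l}) + card (?D (i + l))"
      by (rule card_Un_le)
    also have "card (?w ` {i + l - L..<i + l}) \<le> L"
      by (rule order_trans[OF card_image_le]) auto
    also have "card (?D (i + l)) \<le> L * length (lz_from X (i + l))"
      using 1[OF True] by (simp add: l_def)
    finally show ?thesis
      using True by (subst lz_from.simps) (simp add: l_def)
  qed
qed

text \<open>At \<open>i = 0\<close> no word is old, so \<open>card_new_words_le\<close> counts every
  word of length \<open>L\<close> that occurs.\<close>

lemma lz_size_lower:
  assumes "2 \<le> L" "has_all_words L X"
  shows "2 ^ L \<le> L * lz_size X"
proof -
  let ?S = "(\<lambda>p. take L (drop p X)) ` {p. 0 \<le> p \<and> p + L \<le> length X} - (\<lambda>p. take L (drop p X)) ` {..<0}"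
  have "finite ?S"
    by (rule finite_Diff, rule finite_imageI, rule finite_subset[of _ "{..length X}"]) auto
  then have "card {w :: str. length w = L \<and> set w \<subseteq> {0, 1}} \<le> card ?S"
    using assms(2) by (intro card_mono) (force simp: has_all_words_def)+
  also have "\<dots> \<le> L * length (lz_from X 0)"
    by (rule card_new_words_le[OF assms(1)])
  finally show ?thesis
    unfolding card_binary_words by (simp add: lz_size_def lz77_def)
qed

lemma ones_drop: "ones (drop i X) = ones (take l (drop i X)) + ones (drop (i + l) X)"
  unfolding ones_def by (metis append_take_drop_id drop_drop filter_append length_append add.commute)

text \<open>If a zero followed the phrase, the zeros from \<open>i - 1\<close> on would be a
  self-overlapping source for a copy longer by one, against greedy maximality.\<close>

lemma zero_phrase_reaches_run_end:
  assumes "0 < i" "X ! (i - 1) = 0" "ones (take (lz_len X i) (drop i X)) = 0"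
    "i + lz_len X i < length X"
  shows "X ! (i + lz_len X i) \<noteq> 0"
proof
  define l where "l = lz_len X i"
  assume "X ! (i + lz_len X i) = 0"
  then have last: "X ! (i + l) = 0" by (simp add: l_def)
  have "X ! (i + k) = 0" if "k < l" for k
  proof -
    have "X ! (i + k) \<in> set (take l (drop i X))"
      using that assms(4) unfolding in_set_conv_nth by (intro exI[of _ k]) (auto simp: l_def)
    then show ?thesis
      using assms(3) by (auto simp: ones_def filter_empty_conv l_def)
  qed
  with last have z: "X ! (i + k) = 0" if "k \<le> l" for k
    using that le_neq_implies_less by blast
  have "take (Suc l) (drop (i - 1) X) = take (Suc l) (drop i X)"
  proof (rule nth_equalityI)
    fix k assume "k < length (take (Suc l) (drop (i - 1) X))"
    then have "k \<le> l" by simp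
    moreover have "X ! (i - 1 + k) = 0"
      using z[of "k - 1"] assms(1,2) \<open>k \<le> l\<close> by (cases k) auto
    ultimately show "take (Suc l) (drop (i - 1) X) ! k = take (Suc l) (drop i X) ! k"
      using z[of k] assms(1,4) by (simp add: l_def)
  qed (use assms(1,4) in \<open>auto simp: l_def\<close>)
  then have "occurs_earlier X i (Suc l)"
    using assms(1,4) unfolding occurs_earlier_def l_def
    by (intro conjI exI[of _ "i - 1"]) auto
  from lz_len_occurs(2)[OF this] show False
    by (simp add: l_def)
qed

text \<open>
  Between two nonzero characters there are at most two all-zero phrases: the second one is preceded
  by a zero, hence can be copied from one position to the left up to the end of the run.
\<close>

lemma length_lz_from_le:
  "length (lz_from X i) \<le> 3 * ones (drop i X) +
     (if i < length X \<and> X ! i \<noteq> 0 then 0 else if 0 < i \<and> X ! (i - 1) = 0 then 1 else 2)"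
proof (induction X i rule: lz_from.induct)
  case (1 X i)
  show ?case
  proof (cases "i < length X")
    case False
    then show ?thesis
      by (simp add: lz_from.simps)
  next
    case True
    define l where "l = lz_len X i"
    let ?P = "take l (drop i X)"
    have l: "0 < l" "i + l \<le> length X"
      using True by (auto simp: l_def lz_len_pos lz_len_le)
    have IH: "length (lz_from X i) = Suc (length (lz_from X (i + l)))"
      "length (lz_from X (i + l)) \<le> 3 * ones (drop (i + l) X) +
       (if i + l < length X \<and> X ! (i + l) \<noteq> 0 then 0 else if 0 < i + l \<and> X ! (i + l - 1) = 0 then 1 else 2)"
      using 1[OF True] True by (auto simp: l_def lz_from.simps[of X i])
    show ?thesis
    \<comment> \<open>The additive term is a reserve for the all-zero phrases that may come before
      the next nonzero character. A phrase with a nonzero character gains at least three units: one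
      pays for itself, two refill the reserve. An all-zero phrase takes one unit out of the
      reserve.\<close>
    proof (cases "ones ?P = 0")
      case False
      then show ?thesis
        using IH ones_drop[of i X l] by (auto split: if_splits)
    next
      case zero: True
      have mem: "X ! (i + k) = 0" if "k < l" for k
      proof -
        have "X ! (i + k) \<in> set ?P"
          using that l unfolding in_set_conv_nth by (intro exI[of _ k]) auto
        then show ?thesis
          using zero by (auto simp: ones_def filter_empty_conv)
      qed
      have "X ! i = 0" "X ! (i + l - 1) = 0"
        using mem[of 0] mem[of "l - 1"] l by auto
      show ?thesis
      proof (cases "i + l < length X")
        case False
        then have "length (lz_from X (i + l)) = 0"
          by (simp add: lz_from.simps)
        with IH(1) \<open>X ! i = 0\<close> show ?thesis
          by simp
      next
        case True
        then have "X ! (i + l) \<noteq> 0" if "0 < i" "X ! (i - 1) = 0"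
          using zero_phrase_reaches_run_end[of i X] that zero by (simp add: l_def)
        with IH zero ones_drop[of i X l] \<open>X ! i = 0\<close> \<open>X ! (i + l - 1) = 0\<close> True show ?thesis
          by (auto split: if_splits)
      qed
    qed
  qed
qed

lemma lz_size_upper: "lz_size X \<le> 3 * ones X + 2"
  using length_lz_from_le[of X 0] by (auto simp: lz_size_def lz77_def split: if_splits)

section \<open>Bounds on the number of BWT runs\<close>

lemma run_length_decode:
  "concat (map (\<lambda>(x, l). replicate l x) (run_length_encode xs)) = xs"
proof (induction xs rule: run_length_encode.induct)
  case (2 x xs)
  have "replicate (length (takeWhile (\<lambda>y. y = x) xs)) x = takeWhile (\<lambda>y. y = x) xs"
    by (rule replicate_eqI[symmetric]) (auto dest: set_takeWhileD)
  with 2 show ?case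
    by simp
qed simp

text \<open>Neighbouring runs differ, so every run of \<open>a\<close>, except one at the very
  beginning, follows a run of other characters. Those runs number at most the characters different
  from \<open>a\<close>.\<close>

lemma length_run_length_encode_le:
  "length (run_length_encode xs) \<le>
     2 * length (filter (\<lambda>x. x \<noteq> a) xs) + (if xs \<noteq> [] \<and> hd xs = a then 1 else 0)"
proof (induction xs rule: run_length_encode.induct)
  case (2 x xs)
  let ?t = "takeWhile (\<lambda>y. y = x) xs" and ?d = "dropWhile (\<lambda>y. y = x) xs"
  have "length (filter (\<lambda>x. x \<noteq> a) xs) = length (filter (\<lambda>x. x \<noteq> a) ?t) + length (filter (\<lambda>x. x \<noteq> a) ?d)"
    by (metis filter_append length_append takeWhile_dropWhile_id)
  moreover have "hd ?d \<noteq> x" if "?d \<noteq> []"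
    using hd_dropWhile[OF that] by simp
  ultimately show ?case
    using 2 by (auto split: if_splits)
qed simp

text \<open>Each change marks the last position of a run, and distinct changes belong to distinct
  runs.\<close>

lemma card_changes_le_runs:
  "card {i. Suc i < length xs \<and> xs ! i \<noteq> xs ! Suc i} \<le> length (run_length_encode xs)"
proof (induction xs rule: run_length_encode.induct)
  case (2 x xs)
  let ?C = "\<lambda>xs. {i. Suc i < length xs \<and> xs ! i \<noteq> xs ! Suc i}"
  \<comment> \<open>The head \<open>x\<close> is not counted by \<open>takeWhile\<close>, so the
    first run has length \<open>Suc k\<close> and last index \<open>k\<close>.\<close>
  define k where "k = length (takeWhile (\<lambda>y. y = x) xs)"
  let ?d = "dropWhile (\<lambda>y. y = x) xs"
  have d: "?d = drop k xs"
    by (simp add: k_def dropWhile_eq_drop)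
  have run: "(x # xs) ! i = x" if "i \<le> k" for i
  proof (cases i)
    case (Suc j)
    then have j: "j < length (takeWhile (\<lambda>y. y = x) xs)"
      using that by (simp add: k_def)
    have "takeWhile (\<lambda>y. y = x) xs ! j = x"
      using set_takeWhileD[OF nth_mem[OF j]] by simp
    then show ?thesis
      using Suc takeWhile_nth[OF j] by simp
  qed simp
  have fin: "finite (?C ys)" for ys :: "'a list"
    by (rule finite_subset[of _ "{..length ys}"]) auto
  have "?C (x # xs) \<subseteq> insert k ((\<lambda>i. i + Suc k) ` ?C ?d)"
  proof
    fix i assume i: "i \<in> ?C (x # xs)"
    then have "(x # xs) ! i \<noteq> (x # xs) ! Suc i"
      by blast
    then have "k \<le> i"
      using run[of i] run[of "Suc i"] by (metis Suc_leI nat_le_linear not_le order.strict_implies_order)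
    show "i \<in> insert k ((\<lambda>i. i + Suc k) ` ?C ?d)"
    proof (cases "i = k")
      case False
      define j where "j = i - Suc k"
      have j: "i = j + Suc k"
        using False \<open>k \<le> i\<close> by (simp add: j_def)
      then have "j \<in> ?C ?d"
        using i by (simp add: d add.commute less_diff_conv)
      with j show ?thesis
        by blast
    qed simp
  qed
  then have "card (?C (x # xs)) \<le> card (insert k ((\<lambda>i. i + Suc k) ` ?C ?d))"
    using fin by (intro card_mono) auto
  also have "\<dots> \<le> Suc (card ((\<lambda>i. i + Suc k) ` ?C ?d))"
    by (rule card_insert_le_m1) auto
  also have "card ((\<lambda>i. i + Suc k) ` ?C ?d) \<le> card (?C ?d)"
    using fin by (rule card_image_le)
  also have "\<dots> \<le> length (run_length_encode ?d)"
    by (rule 2)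
  finally show ?case
    by simp
qed simp

section \<open>The BWT as a multiset\<close>

lemma mset_suffix_array: "mset (suffix_array X) = mset [0..<length X]"
  by (simp add: suffix_array_def)

text \<open>Every suffix start except 0 contributes the character before it, which accounts for all
  characters but the last; the start 0 contributes the sentinel.\<close>

lemma mset_bwt_snoc: "mset (bwt (Y @ [y])) = add_mset None (image_mset Some (mset Y))"
proof -
  define g where "g = (\<lambda>p. if p \<noteq> 0 then Some ((Y @ [y]) ! (p - 1)) else None)"
  have "mset (bwt (Y @ [y])) = image_mset g (mset [0..<Suc (length Y)])"
    unfolding bwt_def mset_map mset_suffix_array g_def by simp
  also have "[0..<Suc (length Y)] = 0 # map Suc [0..<length Y]"
    unfolding map_Suc_upt by (rule upt_conv_Cons) simp
  also have "image_mset g (mset \<dots>) = mset (map g \<dots>)"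
    by (rule mset_map[symmetric])
  also have "map g (0 # map Suc [0..<length Y]) = None # map Some Y"
    by (rule nth_equalityI) (auto simp: g_def nth_append nth_Cons split: nat.split)
  finally show ?thesis
    by simp
qed

text \<open>The entries different from \<open>Some 0\<close> are the sentinel and the nonzero
  characters of \<open>Y\<close>, so the number of runs is at most
  \<open>2 * (ones Y + 1) + 1\<close>.\<close>

lemma bwt_runs_upper: "bwt_runs (Y @ [y]) \<le> 2 * ones Y + 3"
proof -
  have "mset (bwt (Y @ [y])) = mset (None # map Some Y)"
    by (simp add: mset_bwt_snoc)
  then have "mset (filter (\<lambda>x. x \<noteq> Some 0) (bwt (Y @ [y]))) =
      mset (filter (\<lambda>x. x \<noteq> Some 0) (None # map Some Y))"
    by (simp only: mset_filter)
  then have "length (filter (\<lambda>x. x \<noteq> Some 0) (bwt (Y @ [y]))) =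
      length (filter (\<lambda>x. x \<noteq> Some 0) (None # map Some Y))"
    by (rule mset_eq_length)
  also have "\<dots> = Suc (ones Y)"
    by (simp add: ones_def filter_map comp_def)
  finally show ?thesis
    using length_run_length_encode_le[of "bwt (Y @ [y])" "Some 0"]
    by (auto simp: bwt_runs_def rlbwt_def split: if_splits)
qed

text \<open>The runs decode to the BWT, whose multiset determines that of the text without its last
  character.\<close>

lemma rlbwt_neq:
  assumes "mset Y \<noteq> mset Z"
  shows "rlbwt (Y @ [y]) \<noteq> rlbwt (Z @ [z])"
proof
  assume "rlbwt (Y @ [y]) = rlbwt (Z @ [z])"
  then have "concat (map (\<lambda>(x, l). replicate l x) (run_length_encode (bwt (Y @ [y])))) =
      concat (map (\<lambda>(x, l). replicate l x) (run_length_encode (bwt (Z @ [z]))))"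
    by (simp only: rlbwt_def)
  then have "bwt (Y @ [y]) = bwt (Z @ [z])"
    by (simp only: run_length_decode)
  then have "mset (bwt (Y @ [y])) = mset (bwt (Z @ [z]))"
    by (simp only:)
  then have "image_mset Some (mset Y) = image_mset Some (mset Z)"
    by (simp add: mset_bwt_snoc)
  then have "image_mset the (image_mset Some (mset Y)) = image_mset the (image_mset Some (mset Z))"
    by (simp only:)
  then show False
    using assms by (simp add: multiset.map_comp comp_def)
qed

section \<open>Changes inside intervals of the suffix array\<close>

text \<open>Truncation preserves the order; this is why suffixes sharing a prefix are contiguous in
  the suffix array.\<close>

lemma take_mono_lex: "u \<le> v \<Longrightarrow> take k u \<le> take k (v :: 'a :: linorder list)"
proof (induction k arbitrary: u v)
  case (Suc k)
  then show ?case
    by (cases u; cases v) auto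
qed simp

lemma exists_change_between:
  assumes "a < b" "b < length xs" "xs ! a \<noteq> xs ! b"
  shows "\<exists>i. a \<le> i \<and> i < b \<and> xs ! i \<noteq> xs ! Suc i"
proof (rule ccontr)
  assume "\<not> ?thesis"
  then have eq: "xs ! i = xs ! Suc i" if "a \<le> i" "i < b" for i
    using that by blast
  have const: "i \<le> b \<Longrightarrow> xs ! i = xs ! a" if "a \<le> i" for i
    using that
  proof (induction i rule: dec_induct)
    case (step i)
    then show ?case
      using eq[of i] by simp
  qed simp
  show False
    using const[of b] assms by simp
qed

text \<open>
  The suffixes with prefix \<open>w\<close> form an interval of the suffix array, and the BWT takes two different
  values on this interval.
\<close>

lemma left_special_change:
  assumes w: "take (Suc k) (drop p X) = a # w" "take (Suc k) (drop q X) = b # w"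
    and "a \<noteq> b" "length w = k" "p + k < length X" "q + k < length X" "0 < k"
  shows "\<exists>i. Suc i < length (bwt X) \<and> bwt X ! i \<noteq> bwt X ! Suc i \<and>
    w = take k (drop (suffix_array X ! i) X)"
proof -
  let ?n = "length X" and ?SA = "suffix_array X"
  have len: "length ?SA = ?n" "length (bwt X) = ?n"
    by (simp_all add: suffix_array_def bwt_def)
  have set: "set ?SA = {..<?n}"
    by (auto simp: suffix_array_def)
  \<comment> \<open>An occurrence of \<open>c # w\<close> at \<open>p\<close> makes the suffix at
    \<open>Suc p\<close> start with \<open>w\<close> and its BWT entry equal \<open>c\<close>. This
    suffix is nonempty because \<open>0 < k\<close>.\<close>
  have occ: "\<exists>i<?n. bwt X ! i = Some c \<and> take k (drop (?SA ! i) X) = w"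
    if "take (Suc k) (drop p X) = c # w" "p + k < ?n" for p c
  proof -
    have "Suc p \<in> set ?SA"
      using that(2) \<open>0 < k\<close> set by auto
    then obtain i where i: "i < ?n" "?SA ! i = Suc p"
      using len by (metis in_set_conv_nth)
    have "drop p X = X ! p # drop (Suc p) X"
      using that(2) by (simp add: Cons_nth_drop_Suc)
    with that(1) have "X ! p = c" "take k (drop (Suc p) X) = w"
      by auto
    with i len show ?thesis
      by (intro exI[of _ i]) (simp add: bwt_def)
  qed
  have sorted: "drop (?SA ! i) X \<le> drop (?SA ! j) X" if "i \<le> j" "j < ?n" for i j
  proof -
    have "sorted (map (\<lambda>i. drop i X) ?SA)"
      by (simp add: suffix_array_def)
    then show ?thesis
      using that len sorted_nth_mono[of "map (\<lambda>i. drop i X) ?SA" i j] by simp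
  qed
  have main: ?thesis
    if i: "bwt X ! i \<noteq> bwt X ! j" "take k (drop (?SA ! i) X) = w"
      "take k (drop (?SA ! j) X) = w" "i < j" "j < ?n" for i j
  proof -
    obtain m where m: "i \<le> m" "m < j" "bwt X ! m \<noteq> bwt X ! Suc m"
      using exists_change_between[of i j "bwt X"] i len by auto
    \<comment> \<open>Index \<open>m\<close> lies between two suffixes that both truncate to
      \<open>w\<close>, so its own truncation is squeezed to \<open>w\<close>.\<close>
    have "w \<le> take k (drop (?SA ! m) X)" "take k (drop (?SA ! m) X) \<le> w"
      using take_mono_lex[OF sorted[of i m], of k] take_mono_lex[OF sorted[of m j], of k] i m by auto
    then show ?thesis
      using m i len by (intro exI[of _ m]) auto
  qed
  obtain i j where "i < ?n" "bwt X ! i = Some a" "take k (drop (?SA ! i) X) = w"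
    "j < ?n" "bwt X ! j = Some b" "take k (drop (?SA ! j) X) = w"
    using occ[OF w(1)] occ[OF w(2)] assms by metis
  then show ?thesis
    using main[of i j] main[of j i] \<open>a \<noteq> b\<close> by (cases i j rule: linorder_cases) auto
qed

text \<open>Both left extensions of each word \<open>w\<close> of length \<open>k\<close> occur,
  which yields a change inside the interval of \<open>w\<close>. Its index determines
  \<open>w\<close>, so different words use different changes.\<close>

lemma bwt_runs_lower:
  assumes "0 < k" "has_all_words (Suc k) X"
  shows "2 ^ k \<le> bwt_runs X"
proof -
  let ?C = "{i. Suc i < length (bwt X) \<and> bwt X ! i \<noteq> bwt X ! Suc i}"
  have "{w :: str. length w = k \<and> set w \<subseteq> {0, 1}} \<subseteq> (\<lambda>i. take k (drop (suffix_array X ! i) X)) ` ?C"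
  proof (rule subsetI)
    fix w :: str assume "w \<in> {w. length w = k \<and> set w \<subseteq> {0, 1}}"
    then have w: "length w = k" "set w \<subseteq> {0, 1}"
      by auto
    have "\<exists>p. p + Suc k \<le> length X \<and> take (Suc k) (drop p X) = c # w" if "c \<in> {0, 1}" for c
      using assms(2) w that unfolding has_all_words_def by (metis insert_subset length_Cons list.simps(15))
    from this[of 0] this[of 1] obtain p q where
      "take (Suc k) (drop p X) = 0 # w" "take (Suc k) (drop q X) = 1 # w"
      "p + k < length X" "q + k < length X"
      by auto
    then show "w \<in> (\<lambda>i. take k (drop (suffix_array X ! i) X)) ` ?C"
      using left_special_change[of k p X 0 w q 1] w(1) assms(1) by auto
  qed
  moreover have fin: "finite ?C"
    by (rule finite_subset[of _ "{..length (bwt X)}"]) auto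
  ultimately have "card {w :: str. length w = k \<and> set w \<subseteq> {0, 1}} \<le> card ?C"
    by (rule surj_card_le[rotated])
  then show ?thesis
    using card_changes_le_runs[of "bwt X"] unfolding card_binary_words by (simp add: bwt_runs_def rlbwt_def)
qed

section \<open>The hard texts\<close>

definition hard_text :: "str \<Rightarrow> nat \<Rightarrow> nat set \<Rightarrow> str" where
  "hard_text P m S = P @ map (\<lambda>i. of_bool (i \<in> S)) [0..<m]"

lemma length_hard_text: "length (hard_text P m S) = length P + m"
  by (simp add: hard_text_def)

lemma hard_text_nth:
  "i < length P + m \<Longrightarrow>
     hard_text P m S ! i = (if i < length P then P ! i else of_bool (i - length P \<in> S))"
  by (auto simp: hard_text_def nth_append)

lemma set_hard_text: "set P \<subseteq> {0, 1} \<Longrightarrow> set (hard_text P m S) \<subseteq> {0, 1}"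
  by (auto simp: hard_text_def)

lemma ones_hard_text:
  assumes "S \<subseteq> {..<m}"
  shows "ones (hard_text P m S) = ones P + card S"
proof -
  have "length (filter (\<lambda>i. i \<in> S) [0..<m]) = card (set (filter (\<lambda>i. i \<in> S) [0..<m]))"
    by (intro distinct_card[symmetric] distinct_filter distinct_upt)
  also have "set (filter (\<lambda>i. i \<in> S) [0..<m]) = S"
    using assms by auto
  finally show ?thesis
    by (simp add: hard_text_def ones_def filter_map comp_def)
qed

lemma ones_cong_mset:
  assumes "mset X = mset Y"
  shows "ones X = ones Y"
proof -
  have "mset (filter (\<lambda>c. c \<noteq> 0) X) = mset (filter (\<lambda>c. c \<noteq> 0) Y)"
    by (simp only: mset_filter assms)
  then show ?thesis
    unfolding ones_def by (rule mset_eq_length)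
qed

lemma inj_on_hard_text: "inj_on (hard_text P m) (Pow {..<m})"
proof (rule inj_onI)
  fix S T assume ST: "S \<in> Pow {..<m}" "T \<in> Pow {..<m}" "hard_text P m S = hard_text P m T"
  have "i \<in> S \<longleftrightarrow> i \<in> T" if "i < m" for i
  proof -
    have "hard_text P m S ! (length P + i) = hard_text P m T ! (length P + i)"
      by (simp only: ST(3))
    with that show ?thesis
      by (simp add: hard_text_nth of_bool_eq_iff)
  qed
  then show "S = T"
    using ST(1,2) by auto
qed

lemma binary_lt_char_bits:
  assumes "2 \<le> \<sigma>" "c \<in> {0, 1 :: nat}"
  shows "c < 2 ^ char_bits \<sigma>"
proof -
  have "\<sigma> \<le> 2 ^ char_bits \<sigma>"
    unfolding char_bits_def by (rule LeastI[of _ \<sigma>]) simp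
  then show ?thesis
    using assms by auto
qed

section \<open>The query bound for counting ones\<close>

text \<open>Relate each \<open>k\<close>-subset to its extensions by one element. There are
  \<open>m - k\<close> of them, each larger set arises from \<open>Suc k\<close> smaller ones, and
  the single differing position determines the partner on either side.\<close>

lemma search_lower_bound:
  fixes A :: "'o qalgorithm" and P :: str and m k Q :: nat
  defines "X \<equiv> \<lambda>S. hard_text P m S @ [0]"
  assumes valid: "valid_alg \<sigma> (length P + m + 1) A"
    and P: "set P \<subseteq> {0, 1}" and "2 \<le> \<sigma>" and "k < m"
    and distinct: "\<And>S T. S \<subseteq> {..<m} \<Longrightarrow> T \<subseteq> {..<m} \<Longrightarrow> card S = k \<Longrightarrow> card T = Suc k \<Longrightarrow>
      f (X S) \<noteq> f (X T)"
    and success: "\<And>S. S \<subseteq> {..<m} \<Longrightarrow> card S \<in> {k, Suc k} \<Longrightarrow>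
      prob_output_within \<sigma> A (X S) Q (f (X S)) \<ge> 2 / 3"
  shows "sqrt (real (m - k) * real (Suc k)) \<le> 36 * real Q"
proof -
  define n where "n = length P + m + 1"
  define V where "V j = {S. S \<subseteq> {..<m} \<and> card S = j}" for j
  define I where "I = (SIGMA S:V k. {..<m} - S)"
  define R where "R = (\<lambda>(S, i). (X S, X (insert i S))) ` I"
  \<comment> \<open>The position must be a function of the two texts. Related texts differ only
    once, so the first difference is the position of the inserted element.\<close>
  define d where "d Y Z = (LEAST i. Y ! i \<noteq> (Z ! i :: nat))" for Y Z
  have finV: "finite (V j)" and cardV: "card (V j) = m choose j" for j
    using n_subsets[of "{..<m}" j] by (auto simp: V_def)
  have finS: "finite S" if "S \<in> V j" for S j
    using that by (auto simp: V_def intro: finite_subset)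
  have insert_V: "insert i S \<in> V (Suc k)" if "(S, i) \<in> I" for S i
    using that finS[of S k] by (auto simp: I_def V_def)
  have len: "length (X S) = n" for S
    by (simp add: X_def length_hard_text n_def)
  have inj: "inj_on X (Pow {..<m})"
    using inj_on_hard_text[of P m] by (auto simp: X_def inj_on_def)
  have nth: "X S ! i = (if i < length P then P ! i else if i < length P + m then of_bool (i - length P \<in> S) else 0)"
    if "i < n" for S i
    using that hard_text_nth[of i P m S]
    by (auto simp: X_def nth_append length_hard_text n_def)
  have differ: "X S ! j \<noteq> X (insert i S) ! j \<longleftrightarrow> j = length P + i" if "(S, i) \<in> I" "j < n" for S i j
    using that by (auto simp: nth I_def of_bool_def)
  have d: "d (X S) (X (insert i S)) = length P + i" if Si: "(S, i) \<in> I" for S i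
    unfolding d_def
  proof (rule Least_equality)
    have "length P + i < n"
      using Si by (auto simp: I_def n_def)
    then show "X S ! (length P + i) \<noteq> X (insert i S) ! (length P + i)"
      using differ[OF Si] by blast
    show "length P + i \<le> j" if "X S ! j \<noteq> X (insert i S) ! j" for j
      using differ[OF Si, of j] that \<open>length P + i < n\<close> by (cases "j < n") auto
  qed
  have R_elim: "\<exists>S i. (S, i) \<in> I \<and> Y = X S \<and> Z = X (insert i S)" if "(Y, Z) \<in> R" for Y Z
    using that by (auto simp: R_def)
  have X_eq: "X S = X T \<longleftrightarrow> S = T" if "S \<subseteq> {..<m}" "T \<subseteq> {..<m}" for S T
    using inj that by (auto simp: inj_on_def)
  have I_sub: "S \<subseteq> {..<m}" "insert i S \<subseteq> {..<m}" "i \<notin> S" "i < m" if "(S, i) \<in> I" for S i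
    using that by (auto simp: I_def V_def)
  have Field: "\<exists>S. S \<subseteq> {..<m} \<and> card S \<in> {k, Suc k} \<and> Y = X S" if "Y \<in> Field R" for Y
  proof -
    obtain Z where Z: "(Y, Z) \<in> R \<or> (Z, Y) \<in> R"
      using \<open>Y \<in> Field R\<close> by (auto simp: Field_def)
    obtain S i where Si: "(S, i) \<in> I" and Y: "Y = X S \<or> Y = X (insert i S)"
      using R_elim Z by blast
    have "S \<in> V k" "insert i S \<in> V (Suc k)"
      using Si insert_V[OF Si] by (auto simp: I_def)
    with Y show ?thesis
      unfolding V_def by blast
  qed
  have "inj_on (\<lambda>(S, i). (X S, X (insert i S))) I"
  proof (rule inj_onI, clarify)
    fix S i T j assume ST: "(S, i) \<in> I" "(T, j) \<in> I" "X S = X T" "X (insert i S) = X (insert j T)"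
    then have "S = T" "insert i S = insert j T"
      using X_eq[OF I_sub(1)[OF ST(1)] I_sub(1)[OF ST(2)]] X_eq[OF I_sub(2)[OF ST(1)] I_sub(2)[OF ST(2)]]
      by simp_all
    then show "S = T \<and> i = j"
      using I_sub(3)[OF ST(1)] I_sub(3)[OF ST(2)] by blast
  qed
  then have "card R = card I"
    by (simp add: R_def card_image)
  also have "\<dots> = (\<Sum>S\<in>V k. card ({..<m} - S))"
    unfolding I_def using finV by (subst card_SigmaI) auto
  also have "\<dots> = (\<Sum>S\<in>V k. m - k)"
    by (intro sum.cong refl) (auto simp: V_def card_Diff_subset finite_subset)
  finally have cardR: "card R = (m choose k) * (m - k)"
    by (simp add: cardV)
  have "Domain R \<subseteq> X ` V k"
    by (auto simp: R_def I_def)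
  then have Dom: "card (Domain R) \<le> m choose k"
    using surj_card_le[OF finV, of _ X] cardV by metis
  have "Range R \<subseteq> X ` V (Suc k)"
    using insert_V by (auto simp: R_def)
  then have Ran: "card (Range R) \<le> m choose Suc k"
    using surj_card_le[OF finV, of _ X] cardV by metis
  \<comment> \<open>Counting the related pairs by their larger set gives the ratio for the
    range.\<close>
  have choose: "Suc k * (m choose Suc k) = (m choose k) * (m - k)"
    by (metis binomial_absorb_comp binomial_absorption mult.commute)
  have "card R \<noteq> 0"
    using \<open>k < m\<close> by (simp add: cardR)
  then have "R \<noteq> {}"
    by auto
  have "sqrt (real (m - k) * real (Suc k)) \<le> 36 * real Q"
  proof (rule adversary_bound[where R = R and d = d and f = f and n = n and A = A and \<sigma> = \<sigma>])
    show "valid_alg \<sigma> n A"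
      using valid by (simp add: n_def)
    show "finite R"
      unfolding R_def I_def using finV by auto
    show "R \<noteq> {}"
      by fact
    show "length Y = n" if "Y \<in> Field R" for Y
      using Field[OF that] len by auto
    show "Y ! i < 2 ^ char_bits \<sigma>" if "Y \<in> Field R" "i < n" for Y i
    proof -
      obtain S where S: "Y = X S"
        using Field[OF \<open>Y \<in> Field R\<close>] by blast
      have "set (X S) \<subseteq> {0, 1}"
        using set_hard_text[OF P, of m S] by (auto simp: X_def)
      moreover have "Y ! i \<in> set (X S)"
        using that(2) len S by simp
      ultimately show ?thesis
        using binary_lt_char_bits[OF \<open>2 \<le> \<sigma>\<close>] by blast
    qed
    show "d Y Z < n" if "(Y, Z) \<in> R" for Y Z
    proof -
      obtain S i where Si: "(S, i) \<in> I" "Y = X S" "Z = X (insert i S)"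
        using R_elim[OF \<open>(Y, Z) \<in> R\<close>] by blast
      then show ?thesis
        using d[OF Si(1)] I_sub(4)[OF Si(1)] by (simp add: n_def)
    qed
    show "Y ! i = Z ! i" if "(Y, Z) \<in> R" "i < n" "i \<noteq> d Y Z" for Y Z i
    proof -
      obtain S i where Si: "(S, i) \<in> I" "Y = X S" "Z = X (insert i S)"
        using R_elim[OF \<open>(Y, Z) \<in> R\<close>] by blast
      then show ?thesis
        using d[OF Si(1)] differ[OF Si(1) that(2)] that(3) by simp
    qed
    show "inj_on (d Y) (R `` {Y})" for Y
    proof (rule inj_onI)
      fix Z Z' assume "Z \<in> R `` {Y}" "Z' \<in> R `` {Y}" and eq: "d Y Z = d Y Z'"
      then have YZ: "(Y, Z) \<in> R" "(Y, Z') \<in> R"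
        by auto
      obtain S i where Si: "(S, i) \<in> I" "Y = X S" "Z = X (insert i S)"
        using R_elim[OF YZ(1)] by blast
      obtain T j where Tj: "(T, j) \<in> I" "Y = X T" "Z' = X (insert j T)"
        using R_elim[OF YZ(2)] by blast
      have "S = T"
        using X_eq[OF I_sub(1)[OF Si(1)] I_sub(1)[OF Tj(1)]] Si(2) Tj(2) by simp
      moreover have "i = j"
        using eq d[OF Si(1)] d[OF Tj(1)] unfolding Si(3) Tj(3) by (simp flip: Si(2) Tj(2))
      ultimately show "Z = Z'"
        by (simp add: Si(3) Tj(3))
    qed
    show "inj_on (\<lambda>Y. d Y Z) (R\<inverse> `` {Z})" for Z
    proof (rule inj_onI)
      fix Y Y' assume "Y \<in> R\<inverse> `` {Z}" "Y' \<in> R\<inverse> `` {Z}" and eq: "d Y Z = d Y' Z"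
      then have YZ: "(Y, Z) \<in> R" "(Y', Z) \<in> R"
        by auto
      obtain S i where Si: "(S, i) \<in> I" "Y = X S" "Z = X (insert i S)"
        using R_elim[OF YZ(1)] by blast
      obtain T j where Tj: "(T, j) \<in> I" "Y' = X T" "Z = X (insert j T)"
        using R_elim[OF YZ(2)] by blast
      have "insert i S = insert j T"
        using X_eq[OF I_sub(2)[OF Si(1)] I_sub(2)[OF Tj(1)]] Si(3) Tj(3) by simp
      moreover have "i = j"
        using eq d[OF Si(1)] d[OF Tj(1)] unfolding Si(2) Tj(2) by (simp flip: Si(3) Tj(3))
      ultimately have "S = T"
        using I_sub(3)[OF Si(1)] I_sub(3)[OF Tj(1)] by (simp add: insert_ident)
      then show "Y = Y'"
        by (simp add: Si(2) Tj(2))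
    qed
    show "real (m - k) * real (card (Domain R)) \<le> real (card R)"
      using mult_le_mono1[OF Dom, of "m - k"] unfolding cardR of_nat_mult[symmetric] of_nat_le_iff
      by (simp add: mult.commute)
    show "real (Suc k) * real (card (Range R)) \<le> real (card R)"
      using mult_le_mono2[OF Ran, of "Suc k"] unfolding cardR choose[symmetric] of_nat_mult[symmetric] of_nat_le_iff .
    show "f Y \<noteq> f Z" if "(Y, Z) \<in> R" for Y Z
    proof -
      obtain S i where "(S, i) \<in> I" "Y = X S" "Z = X (insert i S)"
        using R_elim[OF \<open>(Y, Z) \<in> R\<close>] by blast
      then show ?thesis
        using distinct[of S "insert i S"] insert_V[of S i] by (auto simp: I_def V_def)
    qed
    show "2 / 3 \<le> prob_output_within \<sigma> A Y Q (f Y)" if "Y \<in> Field R" for Y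
      using Field[OF that] success by blast
  qed (use \<open>k < m\<close> in auto)
  then show ?thesis .
qed

section \<open>Choice of parameters and the contradiction\<close>

lemma prob_output_within_mono:
  assumes "q \<le> Q"
  shows "prob_output_within \<sigma> A X q y \<le> prob_output_within \<sigma> A X Q y"
  unfolding prob_output_within_def using assms by (intro sum_mono2) (auto intro: sum_nonneg)

text \<open>\<open>L\<close> is chosen such that \<open>2 ^ L\<close> is within a factor of two of
  \<open>t powr (1 - \<delta>)\<close>. As \<open>L\<close> is only logarithmic, a factor
  \<open>t powr \<delta>\<close> covers it.\<close>

lemma eventually_word_length:
  fixes \<epsilon> :: real
  assumes "0 < \<epsilon>"
  shows "eventually (\<lambda>t. \<exists>L::nat. 2 \<le> L \<and> real L * 2 ^ L \<le> t / 8 \<and> t powr (1 - \<epsilon>) * L \<le> 2 ^ L) at_top"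
proof -
  \<comment> \<open>Half of \<open>\<epsilon>\<close>, because \<open>L\<close> is paid for twice:
    once in the length of the prefix, once in the lower bound on the measure. The cap keeps
    \<open>1 - \<delta>\<close> positive.\<close>
  define \<delta> where "\<delta> = min \<epsilon> 1 / 2"
  have \<delta>: "0 < \<delta>" "\<delta> < 1" "2 * \<delta> \<le> \<epsilon>"
    using assms by (auto simp: \<delta>_def)
  have "eventually (\<lambda>t. log 2 t \<le> t powr \<delta> / 8) at_top"
    using \<delta>(1) by real_asymp
  moreover have "eventually (\<lambda>t. t powr (1 - \<delta>) \<ge> 4) at_top"
    using \<delta>(2) by real_asymp
  moreover have "eventually (\<lambda>t::real. t \<ge> 1) at_top"
    by (rule eventually_ge_at_top)
  ultimately show ?thesis
  proof eventually_elim
    case (elim t)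
    define s where "s = t powr (1 - \<delta>)"
    define L where "L = nat \<lfloor>log 2 s\<rfloor>"
    have s: "4 \<le> s"
      using elim by (simp add: s_def)
    then have log4: "2 \<le> log 2 s"
      by (simp add: le_log_iff)
    then have L: "2 \<le> L" "real L \<le> log 2 s" "log 2 s < real L + 1"
      by (auto simp: L_def le_nat_floor nat_le_iff le_floor_iff)
    have up: "2 ^ L \<le> s"
      using L(2) s by (simp add: le_log_iff powr_realpow)
    have low: "s \<le> 2 * 2 ^ L"
      using L(3) s by (simp add: log_less_iff powr_add powr_realpow)
    have "s \<le> t"
      using elim(3) \<delta> powr_mono[of "1 - \<delta>" 1 t] by (simp add: s_def)
    then have "real L \<le> log 2 t"
      using L(2) s log_mono[of 2 s t] by linarith
    then have L8: "real L \<le> t powr \<delta> / 8"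
      using elim(1) by linarith
    have "real L * 2 ^ L \<le> t powr \<delta> / 8 * s"
      using L8 up by (intro mult_mono) auto
    also have "\<dots> = t / 8"
      using elim(3) by (simp add: s_def flip: powr_add)
    finally have 1: "real L * 2 ^ L \<le> t / 8" .
    have "t powr (1 - \<epsilon>) * real L \<le> t powr (1 - 2 * \<delta>) * (t powr \<delta> / 8)"
      using L8 elim(3) \<delta> by (intro mult_mono powr_mono) auto
    also have "\<dots> = s / 8"
      by (simp add: s_def flip: powr_add)
    also have "\<dots> \<le> 2 ^ L"
      using low zero_le_power[of "2 :: real" L] by linarith
    finally show ?case
      using L(1) 1 by blast
  qed
qed

text \<open>
  The final zero is a fixed last character: the BWT omits only that one, so that it reveals the
  multiset of the remaining characters.
\<close>

lemma no_algorithm_little_o_sqrt: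
  fixes \<xi> \<epsilon> :: real and \<sigma> :: nat and \<mu> :: "str \<Rightarrow> nat" and f :: "str \<Rightarrow> 'o"
  assumes "0 < \<xi>" "\<xi> < 1" "0 < \<epsilon>" "2 \<le> \<sigma>"
    and upper: "\<And>Y. \<mu> (Y @ [0]) \<le> 3 * ones Y + 3"
    and lower: "\<And>L X. 2 \<le> L \<Longrightarrow> has_all_words L X \<Longrightarrow> 2 ^ L \<le> L * \<mu> X"
    and distinct: "\<And>Y Z. mset Y \<noteq> mset Z \<Longrightarrow> f (Y @ [0]) \<noteq> f (Z @ [0])"
  defines "S \<equiv> texts_in_range \<sigma> \<xi> \<epsilon> \<mu>"
  shows "\<not> (\<exists>A q. quantum_computes \<sigma> S f A q \<and>
    (\<lambda>X. real (q X)) \<in> o[long_texts S](\<lambda>X. sqrt (real (\<mu> X) * real (length X))))"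
proof (rule notI, elim exE conjE)
  fix A q
  assume comp: "quantum_computes \<sigma> S f A q"
    and o: "(\<lambda>X. real (q X)) \<in> o[long_texts S](\<lambda>X. sqrt (real (\<mu> X) * real (length X)))"
  \<comment> \<open>With the adversary constant, 36/288 = 1/8 stays below the factor 1/4 that the
    hard texts enforce.\<close>
  have "eventually (\<lambda>X. real (q X) \<le> 1 / 288 * sqrt (real (\<mu> X) * real (length X))) (long_texts S)"
    using landau_o.smallD[OF o, of "1 / 288"] by simp
  then obtain N where N: "\<And>X. N \<le> length X \<Longrightarrow> X \<in> S \<Longrightarrow>
      real (q X) \<le> 1 / 288 * sqrt (real (\<mu> X) * real (length X))"
    unfolding long_texts_def eventually_inf_principal eventually_filtercomap_at_top_linorder by blast
  have lim: "filterlim (\<lambda>n. real n powr \<xi>) at_top sequentially"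
    using \<open>0 < \<xi>\<close> by real_asymp
  \<comment> \<open>The value 100 is a convenient margin for the additive constants below.\<close>
  have "eventually (\<lambda>n. real n powr \<xi> \<ge> 100) sequentially"
    using lim by (auto simp: filterlim_at_top)
  moreover note eventually_compose_filterlim[OF eventually_word_length[OF \<open>0 < \<epsilon>\<close>] lim]
  moreover have "eventually (\<lambda>n. n \<ge> max N 1) sequentially"
    by (rule eventually_ge_at_top)
  ultimately have "eventually (\<lambda>n. n \<ge> max N 1 \<and> real n powr \<xi> \<ge> 100 \<and>
      (\<exists>L::nat. 2 \<le> L \<and> real L * 2 ^ L \<le> real n powr \<xi> / 8 \<and>
        (real n powr \<xi>) powr (1 - \<epsilon>) * L \<le> 2 ^ L)) sequentially"
    by eventually_elim blast
  then obtain n L where n: "N \<le> n" "1 \<le> n" and t100: "real n powr \<xi> \<ge> 100" and L: "2 \<le> L"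
    "real L * 2 ^ L \<le> real n powr \<xi> / 8" "(real n powr \<xi>) powr (1 - \<epsilon>) * L \<le> 2 ^ L"
    unfolding eventually_sequentially by auto
  define t where "t = real n powr \<xi>"
  have "t \<le> n"
    using n(2) \<open>\<xi> < 1\<close> powr_mono[of \<xi> 1 "real n"] by (simp add: t_def)
  define P where "P = all_words L"
  \<comment> \<open>The prefix has at most \<open>t / 8\<close> characters and \<open>k\<close> is
    at most \<open>t / 8\<close>, so the measure is at most \<open>3 * t / 4 + 6\<close>, which is
    below \<open>t\<close>.\<close>
  define k where "k = nat \<lfloor>t / 8\<rfloor>"
  \<comment> \<open>One position is reserved for the final zero.\<close>
  define m where "m = n - length P - 1"
  have "real k = of_int \<lfloor>t / 8\<rfloor>"
    using t100 by (simp add: k_def t_def)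
  then have k: "real k \<le> t / 8" "t / 8 \<le> real (Suc k)"
    by linarith+
  have P: "real (length P) \<le> t / 8"
    using L(2) by (simp add: P_def length_all_words t_def)
  have "length P + 1 \<le> n"
    using P \<open>t \<le> n\<close> t100 unfolding t_def[symmetric] by linarith
  then have m: "length P + m + 1 = n"
    by (simp add: m_def)
  then have "real m = real n - real (length P) - 1"
    by linarith
  then have mk: "real n / 2 \<le> real m - real k"
    using P k(1) \<open>t \<le> n\<close> t100 unfolding t_def[symmetric] by linarith
  then have "k < m"
    using n(2) by linarith
  define X where "X T = hard_text P m T @ [0]" for T
  have X: "X T \<in> S" "length (X T) = n" "real (\<mu> (X T)) \<le> t" if T: "T \<subseteq> {..<m}" "card T \<in> {k, Suc k}" for T
  proof -
    show len: "length (X T) = n"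
      using m by (simp add: X_def length_hard_text)
    have "ones P \<le> length P"
      by (simp add: ones_def)
    then have "ones (hard_text P m T) \<le> length P + Suc k"
      using ones_hard_text[OF T(1), of P] T(2) by auto
    then have "\<mu> (X T) \<le> 3 * (length P + Suc k) + 3"
      unfolding X_def by (intro order_trans[OF upper] add_right_mono mult_left_mono) auto
    then have "real (\<mu> (X T)) \<le> real (3 * (length P + Suc k) + 3)"
      by (rule of_nat_mono)
    then have "real (\<mu> (X T)) \<le> 3 * real (length P) + 3 * real k + 6"
      by simp
    then show ut: "real (\<mu> (X T)) \<le> t"
      using P k(1) t100 unfolding t_def[symmetric] by linarith
    have "has_all_words L (X T)"
      using has_all_words_append[of L] by (simp add: X_def hard_text_def P_def)
    then have "2 ^ L \<le> L * \<mu> (X T)"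
      by (rule lower[OF L(1)])
    then have "(2::real) ^ L \<le> real L * real (\<mu> (X T))"
      by (metis of_nat_le_iff of_nat_mult of_nat_numeral of_nat_power)
    then have "t powr (1 - \<epsilon>) * L \<le> real (\<mu> (X T)) * L"
      using L(3) by (simp add: t_def mult.commute)
    then have "t powr (1 - \<epsilon>) \<le> real (\<mu> (X T))"
      using L(1) by simp
    moreover have "set (X T) \<subseteq> {0, 1}"
      using set_hard_text[OF set_all_words, of L m T] by (auto simp: X_def P_def)
    then have "set (X T) \<subseteq> {..<\<sigma>}"
      using \<open>2 \<le> \<sigma>\<close> by auto
    ultimately show "X T \<in> S"
      using ut len by (auto simp: S_def texts_in_range_def t_def X_def)
  qed
  \<comment> \<open>The adversary bound needs one query limit for all hard texts; the measure is at
    most \<open>t\<close> on them, which makes the limit uniform.\<close>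
  define Q where "Q = nat \<lfloor>1 / 288 * sqrt (t * n)\<rfloor>"
  have success: "prob_output_within \<sigma> (A n) (X T) Q (f (X T)) \<ge> 2 / 3"
    if T: "T \<subseteq> {..<m}" "card T \<in> {k, Suc k}" for T
  proof -
    have "real (q (X T)) \<le> 1 / 288 * sqrt (real (\<mu> (X T)) * real n)"
      using N[OF _ X(1)[OF T]] X(2)[OF T] n(1) by simp
    also have "\<dots> \<le> 1 / 288 * sqrt (t * n)"
      using X(3)[OF T] by (intro mult_left_mono real_sqrt_le_mono mult_right_mono) auto
    finally have "q (X T) \<le> Q"
      by (simp add: Q_def le_nat_floor)
    moreover have "prob_output_within \<sigma> (A n) (X T) (q (X T)) (f (X T)) \<ge> 2 / 3"
      using comp X(1,2)[OF T] by (auto simp: quantum_computes_def)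
    ultimately show ?thesis
      using prob_output_within_mono[of "q (X T)" Q \<sigma> "A n" "X T" "f (X T)"] by linarith
  qed
  have "sqrt (real (m - k) * real (Suc k)) \<le> 36 * real Q"
  proof (rule search_lower_bound[where P = P and f = f and A = "A n" and \<sigma> = \<sigma>, OF _ _ \<open>2 \<le> \<sigma>\<close> \<open>k < m\<close>])
    show "valid_alg \<sigma> (length P + m + 1) (A n)"
      using comp n(2) unfolding m by (simp add: quantum_computes_def)
    show "set P \<subseteq> {0, 1}"
      by (simp only: P_def set_all_words)
    show "f (hard_text P m T @ [0]) \<noteq> f (hard_text P m T' @ [0])"
      if "T \<subseteq> {..<m}" "T' \<subseteq> {..<m}" "card T = k" "card T' = Suc k" for T T'
    proof (rule distinct)
      have "ones (hard_text P m T) \<noteq> ones (hard_text P m T')"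
        using that by (simp add: ones_hard_text)
      then show "mset (hard_text P m T) \<noteq> mset (hard_text P m T')"
        using ones_cong_mset by blast
    qed
    show "2 / 3 \<le> prob_output_within \<sigma> (A n) (hard_text P m T @ [0]) Q (f (hard_text P m T @ [0]))"
      if "T \<subseteq> {..<m}" "card T \<in> {k, Suc k}" for T
      using success[OF that] by (simp only: X_def)
  qed
  also have "36 * real Q \<le> 1 / 8 * sqrt (t * n)"
  proof -
    have "0 \<le> t * n"
      by (simp add: t_def)
    then have "real Q = of_int \<lfloor>1 / 288 * sqrt (t * n)\<rfloor>"
      by (simp add: Q_def)
    then have "real Q \<le> 1 / 288 * sqrt (t * n)"
      by linarith
    then show ?thesis
      by simp
  qed
  finally have 1: "sqrt (real (m - k) * real (Suc k)) \<le> 1 / 8 * sqrt (t * n)" .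
  \<comment> \<open>Since \<open>m - k\<close> is at least \<open>n / 2\<close> and
    \<open>Suc k\<close> at least \<open>t / 8\<close>, the adversary forces a quarter of
    \<open>sqrt (t * n)\<close>, while only an eighth is available.\<close>
  have "sqrt (t * n) / 4 = sqrt (n / 2 * (t / 8))"
  proof -
    have "sqrt (n / 2 * (t / 8)) = sqrt (t * n / 4 ^ 2)"
      by (simp add: field_simps)
    then show ?thesis
      by (simp add: real_sqrt_divide)
  qed
  also have "\<dots> \<le> sqrt (real (m - k) * real (Suc k))"
    using mk k(2) \<open>k < m\<close> t100 by (intro real_sqrt_le_mono mult_mono) (auto simp: of_nat_diff t_def)
  finally have "sqrt (t * n) \<le> 0"
    using 1 by linarith
  moreover have "0 < t * n"
    using t100 n(2) by (simp add: t_def)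
  ultimately show False
    by simp
qed

theorem theorem7p6:
  fixes \<xi> \<epsilon> :: real and \<sigma> :: nat
  assumes "0 < \<xi>" and "\<xi> < 1" and "0 < \<epsilon>" and "2 \<le> \<sigma>"
  shows "(let S = texts_in_range \<sigma> \<xi> \<epsilon> lz_size in
           \<not> (\<exists>A q. quantum_computes \<sigma> S lz77 A q \<and>
                (\<lambda>X. real (q X)) \<in> o[long_texts S](\<lambda>X. sqrt (real (lz_size X) * real (length X))))) \<and>
         (let S = texts_in_range \<sigma> \<xi> \<epsilon> bwt_runs in
           \<not> (\<exists>A q. quantum_computes \<sigma> S rlbwt A q \<and>
                (\<lambda>X. real (q X)) \<in> o[long_texts S](\<lambda>X. sqrt (real (bwt_runs X) * real (length X)))))"
  unfolding Let_def
proof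
  show "\<not> (\<exists>A q. quantum_computes \<sigma> (texts_in_range \<sigma> \<xi> \<epsilon> lz_size) lz77 A q \<and>
      (\<lambda>X. real (q X)) \<in> o[long_texts (texts_in_range \<sigma> \<xi> \<epsilon> lz_size)](\<lambda>X. sqrt (real (lz_size X) * real (length X))))"
  proof (rule no_algorithm_little_o_sqrt[OF assms])
    show "lz_size (Y @ [0]) \<le> 3 * ones Y + 3" for Y
      using lz_size_upper[of "Y @ [0]"] by (simp add: ones_def)
    \<comment> \<open>The phrases concatenate to the text, so the factorization determines it
      entirely.\<close>
    show "lz77 (Y @ [0]) \<noteq> lz77 (Z @ [0])" if "mset Y \<noteq> mset Z" for Y Z
      using that concat_lz77 by (metis butlast_snoc)
  qed (rule lz_size_lower)
  show "\<not> (\<exists>A q. quantum_computes \<sigma> (texts_in_range \<sigma> \<xi> \<epsilon> bwt_runs) rlbwt A q \<and>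
      (\<lambda>X. real (q X)) \<in> o[long_texts (texts_in_range \<sigma> \<xi> \<epsilon> bwt_runs)](\<lambda>X. sqrt (real (bwt_runs X) * real (length X))))"
  proof (rule no_algorithm_little_o_sqrt[OF assms])
    show "bwt_runs (Y @ [0]) \<le> 3 * ones Y + 3" for Y
      using bwt_runs_upper[of Y 0] by linarith
    \<comment> \<open>The run bound concerns words of length \<open>L - 1\<close>; the missing
      factor 2 is covered by \<open>L\<close>.\<close>
    show "2 ^ L \<le> L * bwt_runs X" if "2 \<le> L" "has_all_words L X" for L X
    proof -
      obtain k where k: "L = Suc k" "0 < k"
        using \<open>2 \<le> L\<close> by (cases L) auto
      have "2 ^ L = 2 * 2 ^ k"
        by (simp add: k)
      also have "\<dots> \<le> L * bwt_runs X"
        using bwt_runs_lower[of k X] that k by (intro mult_mono) auto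
      finally show ?thesis .
    qed
  qed (rule rlbwt_neq)
qed

end
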